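(* Let $N\ge0$, $m\ge0$ be integers, $k,j\in\{0,\dots,N\}$, $\omega\in\mathbb{C}$, and $z\in\mathbb{C}\setminus\{0\}$ generic. Let $$\begin{aligned} t^N_{kj}(\mu,z)=\sum_{l=\max(0,k+j-N)}^{\min(k,j)}&\begin{bmatrix}k\\ l\end{bmatrix}\begin{bmatrix}N-k\\ j-l\end{bmatrix}\frac{(q^{2(\mu+N-k-2j+l+2)})_l}{(q^{2(\mu+N-2j+2)})_l}\,\frac{(q^{2(\mu+l-j+2)})_{j-l}}{(q^{2(\mu+N-2j-k+2l+2)})_{j-l}}\\ &\times\gamma(q^{2(N-k-1)}z)\cdots\gamma(q^{2(N-j-k+l)}z)\;\delta(q^{2(N-j-k+l-1)}z)\cdots\delta(z)\\ &\times\alpha(q^{2(N-1)}z)\cdots\alpha(q^{2(N-l)}z)\;\beta(q^{2(N-l-1)}z)\cdots\beta(q^{2(N-k)}z). \end{aligned}$$ Then, for the dynamical representation $\pi^\omega$ on $\mathcal{H}^\omega$ and all meromorphic functions $g$ on $\mathbb{C}$, $$\pi^\omega(t^N_{kj}(\mu,z))(g\,e_m)=\tau^{N\omega}_{kjm}(\lambda,z)\,(T_{N-2j}g)\,e_{m+k-j},$$ where $e_n:=0$ for $n<0$ and $$\begin{aligned} \tau^{N\omega}_{kjm}(\lambda,z)=\;&(-1)^{N-k}\theta(q^2)^{k-j}q^{\frac32k(k-1)+N(N+1)+\frac52j(j+1)+2N(\lambda-k-2j)+m(k-j)+3jk-2k\lambda}\\ &\times\frac{(q^{-2(\lambda+1)},\,q^{2(m+k-j+1)},\,q^{2(N-k-j+1)},\,q^{2(\omega-m-k+1)},\,zq^{2(\lambda+N-2j+m+2)-\omega-1})_j}{(q^2,\,q^{2(\lambda+N-k-2j+2)},\,q^{2(\lambda-j+2)})_j}\\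 &\times\frac{(zq^{-2(\lambda-2j+m+k)+\omega-1})_k}{(q^{-2(\lambda+N-2j)})_k}\;\frac{(q^{-2(\lambda+N-2j-\omega+m)},\,zq^{2(m+k)-\omega+1})_{N-k-j}}{(q^{2(\lambda-j+1)})_{N-k-j}}\;\frac{1}{(zq^{\omega+1})_N}\\ &\times{}_{10}\omega_9\big(q^{2(\lambda+N-2j-k+1)};\,q^{-2k},\,q^{-2j},\,q^{2(\lambda-j+1)},\,q^{2(\lambda+N-2j-\omega+m+1)},\\ &\qquad\qquad q^{2(\lambda+N+2+m-2j)},\,zq^{2(N-m-k)+\omega+1},\,z^{-1}q^{-2(m+k-1)+\omega-1}\big). \end{aligned}$$ The right-hand side is an identity of meromorphic functions, with removable singularities removed as described in the context.
   Context: Notation. $0<p,q<1$ are fixed and algebraically independent over $\mathbb{Q}$; $q^x=\exp(x\log q)$. $\theta(z)=\prod_{j\ge0}(1-zp^j)(1-p^{j+1}/z)$; for $n\ge0$, $(a)_n=\prod_{i=0}^{n-1}\theta(aq^{2i})$ and $(a)_{-n}=1/(aq^{-2n})_n$; $(a_1,\dots,a_r)_n=(a_1)_n\cdots(a_r)_n$; $\begin{bmatrix}k\\ l\end{bmatrix}=\prod_{i=1}^l\frac{\theta(q^{2(k-l+i)})}{\theta(q^{2i})}$. The elliptic hypergeometric series is $${}_{r+1}\omega_r(a_1;a_4,\dots,a_{r+1})=\sum_{s\ge0}\frac{\theta(a_1q^{4s})}{\theta(a_1)}\frac{(a_1,a_4,\dots,a_{r+1})_s\,q^{2s}}{(q^2,a_1q^2/a_4,\dots,a_1q^2/a_{r+1})_s},\qquad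 (a_4\cdots a_{r+1})^2=a_1^{r-3}q^{2(r-5)}.$$ Here it terminates: the sum runs over $0\le s\le\min(k,j)$. When $k+j>N$, the factor $(q^{2(N-k-j+1)})_s$ in the denominators of the series may vanish; this is compensated by the prefactor $(q^{2(N-k-j+1)})_j$, i.e. $(q^{2(N-k-j+1)})_j/(q^{2(N-k-j+1)})_s$ means $(q^{2(N-k-j+s+1)})_{j-s}$. Similarly $(q^{2(\omega-m-k+1)})_j/(q^{2(\omega-m-k+1)})_s$ means $(q^{2(\omega-m-k+s+1)})_{j-s}$, and other quotients are understood as quotients of meromorphic functions. In each string of generators in $t^N_{kj}$ the exponent of $q$ changes by steps of $2$ ($j-l$ factors $\gamma$, $N-k-j+l$ factors $\delta$, $l$ factors $\alpha$, $k-l$ factors $\beta$); empty products equal $1$. The symbols $\alpha(z),\beta(z),\gamma(z),\delta(z)$ together with $f(\lambda)=\mu_l(f)$, $f(\mu)=\mu_r(f)$ ($f$ in the field $M_{\mathfrak{h}^*}$ of meromorphic functions on $\mathbb{C}$) generate the elliptic quantum group algebra $\mathcal{F}_R(M(2))$, the $\mathfrak{h}$-bialgebroid obtained by the FRST-construction from the Andrews–Baxter–Forrester $R$-matrix. The elements $t^N_{kj}(\mu,z)$ are matrix elements of a corepresentation of it. For this statement all that is used is the following dynamical representation of this algebra (an algebra homomorphism into the $\mathbb{C}$-linear operators). $\mathcal{H}^\omega=\bigoplus_{k\ge0}M_{\mathfrak{h}^*}e_k$ is the $M_{\mathfrak{h}^*}$-vector space with basis $\{e_k\}_{k\ge0}$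 (elements of $M_{\mathfrak{h}^*}$ being functions of a variable $\lambda$), $(T_\alpha g)(\lambda)=g(\lambda+\alpha)$, and $\pi^\omega$ is given, for $g\in M_{\mathfrak{h}^*}$ and $zq^{\omega+1}\notin p^{\mathbb{Z}}$, by $\pi^\omega(\alpha(z))(ge_k)=A_k(\lambda,z)(T_{-1}g)e_k$, $\;\pi^\omega(\beta(z))(ge_k)=B_k(\lambda,z)(T_1g)e_{k+1}$, $\pi^\omega(\gamma(z))(ge_k)=C_k(\lambda,z)(T_{-1}g)e_{k-1}$, $\;\pi^\omega(\delta(z))(ge_k)=D_k(\lambda,z)(T_1g)e_k$, $\pi^\omega(f(\mu))(ge_k)=f(\lambda)g\,e_k$, $\;\pi^\omega(f(\lambda))(ge_k)=f(\lambda-\omega+2k)g\,e_k$, where $$A_k(\lambda,z)=q^{2k}\frac{\theta(q^{-2(\lambda+1)-2k})\theta(zq^{\omega-2k+1})}{\theta(q^{-2(\lambda+1)})\theta(zq^{\omega+1})},\qquad B_k(\lambda,z)=q^k\frac{\theta(q^2)\theta(zq^{-2(\lambda+1)+\omega-2k-1})}{\theta(q^{-2(\lambda+1)})\theta(zq^{\omega+1})},$$ $$C_k(\lambda,z)=q^{-(k-1)}\frac{\theta(q^{2k})\theta(q^{2(\omega-k+1)})\theta(zq^{2(\lambda+1)-\omega+2k-1})}{\theta(q^2)\theta(q^{2(\lambda+1)})\theta(zq^{\omega+1})},\quad C_0=0,$$ $$D_k(\lambda,z)=\frac{\theta(q^{-2(\lambda+1-\omega+k)})\theta(zq^{-\omega+2k+1})}{\theta(q^{-2(\lambda+1)})\theta(zq^{\omega+1})}.$$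 *)

theory Defs
  imports
    "HOL-Complex_Analysis.Complex_Analysis"
    "HOL-Computational_Algebra.Polynomial"
    "HOL-Library.Poly_Mapping"
begin

section \<open>Elliptic notation\<close>

text \<open>Bivariate polynomials over the rationals are represented as \<^typ>\<open>rat poly poly\<close>;
  the inner variable is evaluated at \<open>x\<close>, the outer one at \<open>y\<close>.\<close>

definition algebraically_independent2 :: "real \<Rightarrow> real \<Rightarrow> bool" where
  "algebraically_independent2 x y \<longleftrightarrow>
     (\<forall>P :: rat poly poly. P \<noteq> 0 \<longrightarrow>
        poly (map_poly (\<lambda>c. poly (map_poly of_rat c) x) P) y \<noteq> 0)"

definition qpow :: "real \<Rightarrow> complex \<Rightarrow> complex" where
  "qpow q x = exp (x * of_real (ln q))"

definition theta :: "real \<Rightarrow> complex \<Rightarrow> complex" where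
  "theta p z = prodinf (\<lambda>j. (1 - z * of_real p ^ j) * (1 - of_real p ^ Suc j / z))"

definition powers_of :: "real \<Rightarrow> complex set" where
  "powers_of p = {of_real p powi n | n :: int. True}"

definition tfact :: "real \<Rightarrow> real \<Rightarrow> complex \<Rightarrow> int \<Rightarrow> complex" where
  "tfact p q a n =
     (if n \<ge> 0 then \<Prod>i\<in>{0..<n}. theta p (a * qpow q (2 * of_int i))
      else 1 / (\<Prod>i\<in>{0..<-n}. theta p (a * qpow q (2 * of_int n) * qpow q (2 * of_int i))))"

definition tfacts :: "real \<Rightarrow> real \<Rightarrow> complex list \<Rightarrow> int \<Rightarrow> complex" where
  "tfacts p q as n = (\<Prod>a\<leftarrow>as. tfact p q a n)"

definition ell_binomial :: "real \<Rightarrow> real \<Rightarrow> int \<Rightarrow> int \<Rightarrow> complex" where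
  "ell_binomial p q k l =
     (\<Prod>i\<in>{1..l}. theta p (qpow q (2 * of_int (k - l + i))) / theta p (qpow q (2 * of_int i)))"

text \<open>The elliptic hypergeometric series with first parameter \<open>a\<close> (playing the role of
  \<open>a\<^sub>1\<close>) and remaining parameters \<open>as\<close> (playing the role of \<open>a\<^sub>4, \<dots>, a\<^bsub>r+1\<^esub>\<close>),
  summed over \<open>0 \<le> s \<le> n\<close>.\<close>

definition ehs :: "real \<Rightarrow> real \<Rightarrow> int \<Rightarrow> complex \<Rightarrow> complex list \<Rightarrow> complex" where
  "ehs p q n a as =
     (\<Sum>s\<in>{0..n}. theta p (a * qpow q (4 * of_int s)) / theta p a
        * (tfacts p q (a # as) s * qpow q (2 * of_int s))
        / tfacts p q (qpow q 2 # map (\<lambda>b. a * qpow q 2 / b) as) s)"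

text \<open>The product of \<open>\<Prod>b\<leftarrow>bs. (a q\<^sup>2/b)\<^sub>j\<close> and the series with parameters \<open>as @ bs\<close>, in which the
  quotient \<open>(a q\<^sup>2/b)\<^sub>j / (a q\<^sup>2/b)\<^sub>s\<close> is read as \<open>(a q\<^bsup>2+2s\<^esup>/b)\<^bsub>j-s\<^esub>\<close> for \<open>b\<close> in \<open>bs\<close>; see
  \<open>ehs_compensated_eq\<close> below.\<close>

definition ehs_compensated ::
  "real \<Rightarrow> real \<Rightarrow> int \<Rightarrow> int \<Rightarrow> complex \<Rightarrow> complex list \<Rightarrow> complex list \<Rightarrow> complex" where
  "ehs_compensated p q n j a as bs =
     (\<Sum>s\<in>{0..n}. theta p (a * qpow q (4 * of_int s)) / theta p a
        * (tfacts p q (a # as @ bs) s * qpow q (2 * of_int s))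
        / tfacts p q (qpow q 2 # map (\<lambda>b. a * qpow q 2 / b) as) s
        * tfacts p q (map (\<lambda>b. a * qpow q 2 / b * qpow q (2 * of_int s)) bs) (j - s))"

lemma qpow_add: "qpow q (x + y) = qpow q x * qpow q y"
  by (simp add: qpow_def distrib_right exp_add)

lemma tfact_split:
  assumes "0 \<le> s" "s \<le> j"
  shows "tfact p q c j = tfact p q c s * tfact p q (c * qpow q (2 * of_int s)) (j - s)"
proof -
  let ?f = "\<lambda>i::int. theta p (c * qpow q (2 * of_int i))"
  have "prod ?f {0..<j} = prod ?f {0..<s} * prod ?f {s..<j}"
    using assms by (subst prod.union_disjoint [symmetric]) (auto intro: arg_cong2[where f = prod])
  also have "prod ?f {s..<j} = (\<Prod>i\<in>{0..<j - s}. ?f (i + s))"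
    by (rule prod.reindex_bij_witness[of _ "\<lambda>i. i + s" "\<lambda>i. i - s"]) auto
  finally show ?thesis
    using assms by (simp add: tfact_def algebra_simps qpow_add)
qed

lemma ehs_compensated_eq:
  assumes "n \<le> j" and nz: "\<And>b. b \<in> set bs \<Longrightarrow> tfact p q (a * qpow q 2 / b) j \<noteq> 0"
  shows "ehs_compensated p q n j a as bs =
           tfacts p q (map (\<lambda>b. a * qpow q 2 / b) bs) j * ehs p q n a (as @ bs)"
proof -
  have *: "tfacts p q (map (\<lambda>b. a * qpow q 2 / b * qpow q (2 * of_int s)) bs) (j - s) =
      tfacts p q (map (\<lambda>b. a * qpow q 2 / b) bs) j / tfacts p q (map (\<lambda>b. a * qpow q 2 / b) bs) s"
    if s: "0 \<le> s" "s \<le> n" for s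
    using nz
  proof (induction bs)
    case Nil
    then show ?case by (simp add: tfacts_def)
  next
    case (Cons b bs)
    have split: "tfact p q (a * qpow q 2 / b) j = tfact p q (a * qpow q 2 / b) s *
        tfact p q (a * qpow q 2 / b * qpow q (2 * of_int s)) (j - s)"
      using s assms(1) by (intro tfact_split) auto
    have "tfact p q (a * qpow q 2 / b) j \<noteq> 0" using Cons.prems by simp
    then have "tfact p q (a * qpow q 2 / b) s \<noteq> 0" using split by auto
    then show ?case using Cons split by (simp add: tfacts_def)
  qed
  show ?thesis
    unfolding ehs_compensated_def ehs_def sum_distrib_left
  proof (rule sum.cong, goal_cases)
    case (2 s)
    then show ?case using *[of s] by (simp add: tfacts_def mult_ac)
  qed simp
qed


section \<open>The field of meromorphic functions on the complex plane\<close>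

text \<open>Meromorphic functions are identified if they agree outside a closed discrete set.\<close>

definition mero_eq :: "(complex \<Rightarrow> complex) \<Rightarrow> (complex \<Rightarrow> complex) \<Rightarrow> bool" where
  "mero_eq f g \<longleftrightarrow> f meromorphic_on UNIV \<and> g meromorphic_on UNIV \<and>
     (\<forall>\<^sub>F z in cosparse UNIV. f z = g z)"

lemma mero_eq_refl_iff: "mero_eq f f \<longleftrightarrow> f meromorphic_on UNIV"
  by (simp add: mero_eq_def)

quotient_type mero = "complex \<Rightarrow> complex" / partial: mero_eq
proof (rule part_equivpI)
  show "\<exists>f. mero_eq f f"
    by (auto simp: mero_eq_def intro: exI[of _ "\<lambda>_. 0"])
  show "symp mero_eq"
    by (auto simp: symp_def mero_eq_def eq_commute)
  show "transp mero_eq"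
    by (auto simp: transp_def mero_eq_def elim: eventually_elim2)
qed

instantiation mero :: field
begin

lift_definition zero_mero :: mero is "\<lambda>_. 0"
  by (auto simp: mero_eq_def)
lift_definition one_mero :: mero is "\<lambda>_. 1"
  by (auto simp: mero_eq_def)
lift_definition plus_mero :: "mero \<Rightarrow> mero \<Rightarrow> mero" is "\<lambda>f g z. f z + g z"
  by (auto simp: mero_eq_def intro: meromorphic_intros elim: eventually_elim2)
lift_definition minus_mero :: "mero \<Rightarrow> mero \<Rightarrow> mero" is "\<lambda>f g z. f z - g z"
  by (auto simp: mero_eq_def intro: meromorphic_intros elim: eventually_elim2)
lift_definition times_mero :: "mero \<Rightarrow> mero \<Rightarrow> mero" is "\<lambda>f g z. f z * g z"
  by (auto simp: mero_eq_def intro: meromorphic_intros elim: eventually_elim2)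
lift_definition divide_mero :: "mero \<Rightarrow> mero \<Rightarrow> mero" is "\<lambda>f g z. f z / g z"
  by (auto simp: mero_eq_def intro: meromorphic_intros elim: eventually_elim2)
lift_definition uminus_mero :: "mero \<Rightarrow> mero" is "\<lambda>f z. - f z"
  by (auto simp: mero_eq_def intro: meromorphic_intros elim: eventually_mono)
lift_definition inverse_mero :: "mero \<Rightarrow> mero" is "\<lambda>f z. inverse (f z)"
  by (auto simp: mero_eq_def intro: meromorphic_intros elim: eventually_mono)

instance
proof
  fix a b c :: mero
  show "a * b * c = a * (b * c)" "a * b = b * a" "1 * a = a"
    "a + b + c = a + (b + c)" "a + b = b + a" "0 + a = a" "- a + a = 0" "a - b = a + - b"
    "(a + b) * c = a * c + b * c" "a div b = a * inverse b"
    by (transfer; auto simp: mero_eq_def algebra_simps divide_inverse intro: meromorphic_intros)+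
  show "(0::mero) \<noteq> 1"
    by transfer (simp add: mero_eq_def)
  show "inverse (0::mero) = 0"
    by transfer (simp add: mero_eq_def meromorphic_on_const)
  show "a \<noteq> 0 \<Longrightarrow> inverse a * a = 1"
  proof (transfer, goal_cases)
    case (1 f)
    then have f: "f meromorphic_on UNIV" and "\<not> (\<forall>\<^sub>F z in cosparse UNIV. f z = 0)"
      by (auto simp: mero_eq_def)
    with meromorphic_imp_constant_or_avoid[OF f, of 0]
    have "\<forall>\<^sub>F z in cosparse UNIV. f z \<noteq> 0" by auto
    then have "\<forall>\<^sub>F z in cosparse UNIV. inverse (f z) * f z = 1"
      by eventually_elim simp
    with f show ?case by (auto simp: mero_eq_def intro: meromorphic_intros)
  qed
qed

end

text \<open>The element of the field represented by a function; functions that are not meromorphic are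
  sent to \<open>0\<close>.\<close>

lift_definition mero_of :: "(complex \<Rightarrow> complex) \<Rightarrow> mero" is
  "\<lambda>f. if f meromorphic_on UNIV then f else (\<lambda>_. 0)"
  by (auto simp: mero_eq_def intro: meromorphic_on_const)

lemma eventually_cosparse_shift:
  fixes P :: "complex \<Rightarrow> bool"
  assumes "\<forall>\<^sub>F z in cosparse UNIV. P z"
  shows "\<forall>\<^sub>F z in cosparse UNIV. P (z + a)"
proof -
  have "(+) (-a) ` {z. \<not> P z} sparse_in UNIV"
    using assms by (intro sparse_in_translate_UNIV) (simp add: eventually_cosparse)
  also have "(+) (-a) ` {z. \<not> P z} = {z. \<not> P (z + a)}"
    by (force simp: image_iff intro: exI[of _ "_ + a"])
  finally show ?thesis by (simp add: eventually_cosparse)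
qed

lift_definition shift :: "complex \<Rightarrow> mero \<Rightarrow> mero" is "\<lambda>a f z. f (z + a)"
  by (auto simp: mero_eq_def intro!: eventually_cosparse_shift analytic_intros
           elim: meromorphic_on_compose)


section \<open>Dynamical representations\<close>

text \<open>The space \<open>\<H>\<^sup>\<omega>\<close> is \<^typ>\<open>nat \<Rightarrow>\<^sub>0 mero\<close>; \<open>bvec g k\<close> is the vector \<open>g e\<^sub>k\<close>, where \<open>e\<^sub>k = 0\<close> for \<open>k < 0\<close>.\<close>

definition bvec :: "mero \<Rightarrow> int \<Rightarrow> (nat \<Rightarrow>\<^sub>0 mero)" where
  "bvec g k = (if k < 0 then 0 else Poly_Mapping.single (nat k) g)"

definition scaleH :: "complex \<Rightarrow> (nat \<Rightarrow>\<^sub>0 mero) \<Rightarrow> (nat \<Rightarrow>\<^sub>0 mero)" where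
  "scaleH c v = Poly_Mapping.map (\<lambda>g. mero_of (\<lambda>_. c) * g) v"

definition coefA :: "real \<Rightarrow> real \<Rightarrow> complex \<Rightarrow> int \<Rightarrow> complex \<Rightarrow> complex \<Rightarrow> complex" where
  "coefA p q \<omega> k lam z =
     qpow q (2 * of_int k)
     * (theta p (qpow q (- 2 * (lam + 1) - 2 * of_int k)) * theta p (z * qpow q (\<omega> - 2 * of_int k + 1)))
     / (theta p (qpow q (- 2 * (lam + 1))) * theta p (z * qpow q (\<omega> + 1)))"

definition coefB :: "real \<Rightarrow> real \<Rightarrow> complex \<Rightarrow> int \<Rightarrow> complex \<Rightarrow> complex \<Rightarrow> complex" where
  "coefB p q \<omega> k lam z =
     qpow q (of_int k)
     * (theta p (qpow q 2) * theta p (z * qpow q (- 2 * (lam + 1) + \<omega> - 2 * of_int k - 1)))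
     / (theta p (qpow q (- 2 * (lam + 1))) * theta p (z * qpow q (\<omega> + 1)))"

definition coefC :: "real \<Rightarrow> real \<Rightarrow> complex \<Rightarrow> int \<Rightarrow> complex \<Rightarrow> complex \<Rightarrow> complex" where
  "coefC p q \<omega> k lam z =
     (if k = 0 then 0 else
        qpow q (- of_int (k - 1))
        * (theta p (qpow q (2 * of_int k)) * theta p (qpow q (2 * (\<omega> - of_int k + 1)))
           * theta p (z * qpow q (2 * (lam + 1) - \<omega> + 2 * of_int k - 1)))
        / (theta p (qpow q 2) * theta p (qpow q (2 * (lam + 1))) * theta p (z * qpow q (\<omega> + 1))))"

definition coefD :: "real \<Rightarrow> real \<Rightarrow> complex \<Rightarrow> int \<Rightarrow> complex \<Rightarrow> complex \<Rightarrow> complex" where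
  "coefD p q \<omega> k lam z =
     theta p (qpow q (- 2 * (lam + 1 - \<omega> + of_int k))) * theta p (z * qpow q (- \<omega> + 2 * of_int k + 1))
     / (theta p (qpow q (- 2 * (lam + 1))) * theta p (z * qpow q (\<omega> + 1)))"

text \<open>A unital \<open>\<complex>\<close>-algebra on the type \<open>'a\<close> containing elements \<open>\<alpha>(z), \<beta>(z), \<gamma>(z), \<delta>(z)\<close>,
  \<open>f(\<lambda>) = \<mu>\<^sub>l(f)\<close> and \<open>f(\<mu>) = \<mu>\<^sub>r(f)\<close>, together with an algebra homomorphism \<open>\<pi>\<close> into the
  \<open>\<complex>\<close>-linear operators on \<open>\<H>\<^sup>\<omega>\<close> acting on these elements as the dynamical representation
  \<open>\<pi>\<^sup>\<omega>\<close>. No relations between the generators are imposed, so that the elliptic quantum group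
  algebra \<open>\<F>\<^sub>R(M(2))\<close> with its dynamical representation is one instance.\<close>

locale dynamical_rep = vector_space sc
  for sc :: "complex \<Rightarrow> 'a::ring_1 \<Rightarrow> 'a" +
  fixes p q :: real and \<omega> :: complex
    and \<alpha> \<beta> \<gamma> \<delta> :: "complex \<Rightarrow> 'a"
    and \<mu>\<^sub>l \<mu>\<^sub>r :: "mero \<Rightarrow> 'a"
    and \<pi> :: "'a \<Rightarrow> (nat \<Rightarrow>\<^sub>0 mero) \<Rightarrow> (nat \<Rightarrow>\<^sub>0 mero)"
  assumes scale_mult_left: "sc c x * y = sc c (x * y)"
    and scale_mult_right: "x * sc c y = sc c (x * y)"
    and op_add: "\<pi> x (v + w) = \<pi> x v + \<pi> x w"
    and op_scale: "\<pi> x (scaleH c v) = scaleH c (\<pi> x v)"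
    and hom_add: "\<pi> (x + y) v = \<pi> x v + \<pi> y v"
    and hom_scale: "\<pi> (sc c x) v = scaleH c (\<pi> x v)"
    and hom_mult: "\<pi> (x * y) v = \<pi> x (\<pi> y v)"
    and hom_one: "\<pi> 1 v = v"
    and rep_\<alpha>: "\<lbrakk>z \<noteq> 0; z * qpow q (\<omega> + 1) \<notin> powers_of p; k \<ge> 0\<rbrakk> \<Longrightarrow>
          \<pi> (\<alpha> z) (bvec g k) = bvec (mero_of (\<lambda>lam. coefA p q \<omega> k lam z) * shift (-1) g) k"
    and rep_\<beta>: "\<lbrakk>z \<noteq> 0; z * qpow q (\<omega> + 1) \<notin> powers_of p; k \<ge> 0\<rbrakk> \<Longrightarrow>
          \<pi> (\<beta> z) (bvec g k) = bvec (mero_of (\<lambda>lam. coefB p q \<omega> k lam z) * shift 1 g) (k + 1)"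
    and rep_\<gamma>: "\<lbrakk>z \<noteq> 0; z * qpow q (\<omega> + 1) \<notin> powers_of p; k \<ge> 0\<rbrakk> \<Longrightarrow>
          \<pi> (\<gamma> z) (bvec g k) = bvec (mero_of (\<lambda>lam. coefC p q \<omega> k lam z) * shift (-1) g) (k - 1)"
    and rep_\<delta>: "\<lbrakk>z \<noteq> 0; z * qpow q (\<omega> + 1) \<notin> powers_of p; k \<ge> 0\<rbrakk> \<Longrightarrow>
          \<pi> (\<delta> z) (bvec g k) = bvec (mero_of (\<lambda>lam. coefD p q \<omega> k lam z) * shift 1 g) k"
    and rep_\<mu>\<^sub>r: "k \<ge> 0 \<Longrightarrow> \<pi> (\<mu>\<^sub>r f) (bvec g k) = bvec (f * g) k"
    and rep_\<mu>\<^sub>l: "k \<ge> 0 \<Longrightarrow> \<pi> (\<mu>\<^sub>l f) (bvec g k) = bvec (shift (2 * of_int k - \<omega>) f * g) k"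


section \<open>The matrix elements and their action\<close>

text \<open>The strings of generators run over \<open>i\<close> in the order of the lists; for instance the
  \<open>\<gamma>\<close>-string is \<open>\<gamma>(q\<^bsup>2(N-k-1)\<^esup>z) \<cdots> \<gamma>(q\<^bsup>2(N-j-k+l)\<^esup>z)\<close>.\<close>

definition t_coef :: "real \<Rightarrow> real \<Rightarrow> int \<Rightarrow> int \<Rightarrow> int \<Rightarrow> int \<Rightarrow> complex \<Rightarrow> complex" where
  "t_coef p q N k j l mu =
     tfact p q (qpow q (2 * (mu + of_int (N - k - 2*j + l + 2)))) l
     / tfact p q (qpow q (2 * (mu + of_int (N - 2*j + 2)))) l
     * (tfact p q (qpow q (2 * (mu + of_int (l - j + 2)))) (j - l)
        / tfact p q (qpow q (2 * (mu + of_int (N - 2*j - k + 2*l + 2)))) (j - l))"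

definition t_elem ::
  "(complex \<Rightarrow> 'a::ring_1 \<Rightarrow> 'a) \<Rightarrow> real \<Rightarrow> real \<Rightarrow> (complex \<Rightarrow> 'a) \<Rightarrow> (complex \<Rightarrow> 'a) \<Rightarrow>
   (complex \<Rightarrow> 'a) \<Rightarrow> (complex \<Rightarrow> 'a) \<Rightarrow> (mero \<Rightarrow> 'a) \<Rightarrow> int \<Rightarrow> int \<Rightarrow> int \<Rightarrow> complex \<Rightarrow> 'a" where
  "t_elem sc p q \<alpha> \<beta> \<gamma> \<delta> \<mu>\<^sub>r N k j z =
     (\<Sum>l\<in>{max 0 (k + j - N)..min k j}.
        sc (ell_binomial p q k l * ell_binomial p q (N - k) (j - l))
          (\<mu>\<^sub>r (mero_of (t_coef p q N k j l))
           * (\<Prod>i\<leftarrow>[1..j - l]. \<gamma> (qpow q (2 * of_int (N - k - i)) * z))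
           * (\<Prod>i\<leftarrow>[1..N - k - j + l]. \<delta> (qpow q (2 * of_int (N - j - k + l - i)) * z))
           * (\<Prod>i\<leftarrow>[1..l]. \<alpha> (qpow q (2 * of_int (N - i)) * z))
           * (\<Prod>i\<leftarrow>[1..k - l]. \<beta> (qpow q (2 * of_int (N - l - i)) * z))))"

text \<open>The coefficient \<open>\<tau>\<close>, including the series \<open>\<^sub>1\<^sub>0\<omega>\<^sub>9\<close> with first parameter
  \<open>a\<^sub>1 = q\<^bsup>2(\<lambda>+N-2j-k+1)\<^esup>\<close>, which terminates at \<open>s = min k j\<close>.
  The factors \<open>(q\<^bsup>2(N-k-j+1)\<^esup>)\<^sub>j\<close> and \<open>(q\<^bsup>2(\<omega>-m-k+1)\<^esup>)\<^sub>j\<close> of the numerator are not listed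
  separately: they are the factors \<open>(a\<^sub>1q\<^sup>2/b)\<^sub>j\<close> absorbed in \<^const>\<open>ehs_compensated\<close>, for the
  parameters \<open>b = q\<^bsup>2(\<lambda>-j+1)\<^esup>\<close> and \<open>b = q\<^bsup>2(\<lambda>+N-2j-\<omega>+m+1)\<^esup>\<close> respectively. The series is
  symmetric in all its parameters except the first one.\<close>

definition tau ::
  "real \<Rightarrow> real \<Rightarrow> int \<Rightarrow> complex \<Rightarrow> int \<Rightarrow> int \<Rightarrow> int \<Rightarrow> complex \<Rightarrow> complex \<Rightarrow> complex" where
  "tau p q N \<omega> k j m lam z =
     (-1) powi (N - k) * theta p (qpow q 2) powi (k - j)
     * qpow q (3/2 * of_int (k * (k - 1)) + of_int (N * (N + 1)) + 5/2 * of_int (j * (j + 1))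
               + 2 * of_int N * (lam - of_int k - 2 * of_int j)
               + of_int (m * (k - j)) + of_int (3 * j * k) - 2 * of_int k * lam)
     * (tfacts p q
          [qpow q (- 2 * (lam + 1)),
           qpow q (2 * of_int (m + k - j + 1)),
           z * qpow q (2 * (lam + of_int (N - 2*j + m + 2)) - \<omega> - 1)] j
        / tfacts p q
          [qpow q 2,
           qpow q (2 * (lam + of_int (N - k - 2*j + 2))),
           qpow q (2 * (lam + of_int (2 - j)))] j)
     * (tfact p q (z * qpow q (- 2 * (lam + of_int (m + k - 2*j)) + \<omega> - 1)) k
        / tfact p q (qpow q (- 2 * (lam + of_int (N - 2*j)))) k)
     * (tfacts p q
          [qpow q (- 2 * (lam + of_int (N - 2*j + m) - \<omega>)),
           z * qpow q (2 * of_int (m + k) - \<omega> + 1)] (N - k - j)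
        / tfact p q (qpow q (2 * (lam + of_int (1 - j)))) (N - k - j))
     * (1 / tfact p q (z * qpow q (\<omega> + 1)) N)
     * ehs_compensated p q (min k j) j
         (qpow q (2 * (lam + of_int (N - 2*j - k + 1))))
         [qpow q (- 2 * of_int k),
          qpow q (- 2 * of_int j),
          qpow q (2 * (lam + of_int (N + 2 + m - 2*j))),
          z * qpow q (2 * of_int (N - m - k) + \<omega> + 1),
          inverse z * qpow q (- 2 * of_int (m + k - 1) + \<omega> - 1)]
         [qpow q (2 * (lam + of_int (1 - j))),
          qpow q (2 * (lam + of_int (N - 2*j + m + 1) - \<omega>))]"


section \<open>Existence of dynamical representations\<close>

text \<open>The assumptions of \<^locale>\<open>dynamical_rep\<close> are satisfied, for instance, by the algebra of all
  \<open>\<complex>\<close>-linear operators on \<open>\<H>\<^sup>\<omega>\<close>, for any choice of \<open>p\<close>, \<open>q\<close> and \<open>\<omega>\<close>.\<close>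


lemma mero_of_const_add: "mero_of (\<lambda>_. c + d) = mero_of (\<lambda>_. c) + mero_of (\<lambda>_. d)"
  by transfer (simp add: mero_eq_def meromorphic_on_const)

lemma mero_of_const_mult: "mero_of (\<lambda>_. c * d) = mero_of (\<lambda>_. c) * mero_of (\<lambda>_. d)"
  by transfer (simp add: mero_eq_def meromorphic_on_const)

lemma mero_of_const_1: "mero_of (\<lambda>_. 1) = 1"
  by transfer (simp add: mero_eq_def meromorphic_on_const)

lemma meromorphic_shift: "f meromorphic_on UNIV \<Longrightarrow> (\<lambda>z. f (z + a)) meromorphic_on UNIV"
  for a :: complex
  by (erule meromorphic_on_compose) (auto intro!: analytic_intros)

lemma shift_add: "shift a (f + g) = shift a f + shift a g"
  by transfer (auto simp: mero_eq_def intro!: meromorphic_intros meromorphic_shift)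

lemma shift_mult: "shift a (f * g) = shift a f * shift a g"
  by transfer (auto simp: mero_eq_def intro!: meromorphic_intros meromorphic_shift)

lemma shift_const: "shift a (mero_of (\<lambda>_. c)) = mero_of (\<lambda>_. c)"
  by transfer (simp add: mero_eq_def meromorphic_on_const)

lemma lookup_scaleH:
  "Poly_Mapping.lookup (scaleH c v) k = mero_of (\<lambda>_. c) * Poly_Mapping.lookup v k"
  by (simp add: scaleH_def Poly_Mapping.map.rep_eq when_def)

lemma scaleH_add_right: "scaleH c (v + w) = scaleH c v + scaleH c w"
  by (rule poly_mapping_eqI) (simp add: lookup_scaleH lookup_add distrib_left)

lemma scaleH_add_left: "scaleH (c + d) v = scaleH c v + scaleH d v"
  by (rule poly_mapping_eqI) (simp add: lookup_scaleH lookup_add distrib_right mero_of_const_add)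

lemma scaleH_scaleH: "scaleH c (scaleH d v) = scaleH (c * d) v"
  by (rule poly_mapping_eqI) (simp add: lookup_scaleH mero_of_const_mult)

lemma scaleH_one: "scaleH 1 v = v"
  by (rule poly_mapping_eqI) (simp add: lookup_scaleH mero_of_const_1)

definition linH :: "((nat \<Rightarrow>\<^sub>0 mero) \<Rightarrow> (nat \<Rightarrow>\<^sub>0 mero)) \<Rightarrow> bool" where
  "linH T \<longleftrightarrow> (\<forall>v w. T (v + w) = T v + T w) \<and> (\<forall>c v. T (scaleH c v) = scaleH c (T v))"

typedef endH = "Collect linH" morphisms apply_endH Abs_endH
  by (rule exI[of _ "\<lambda>v. v"]) (simp add: linH_def)

setup_lifting type_definition_endH

lemma scaleH_zero: "scaleH c 0 = 0"
  by (rule poly_mapping_eqI) (simp add: lookup_scaleH)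

lemma scaleH_uminus: "scaleH c (- v) = - scaleH c v"
  by (metis add_eq_0_iff2 scaleH_add_right scaleH_zero)

lemma scaleH_diff: "scaleH c (v - w) = scaleH c v - scaleH c w"
  by (metis add_diff_cancel diff_add_cancel scaleH_add_right)

instantiation endH :: ring_1
begin
lift_definition zero_endH :: endH is "\<lambda>_. 0" by (simp add: linH_def scaleH_zero)
lift_definition one_endH :: endH is "\<lambda>v. v" by (simp add: linH_def)
lift_definition plus_endH :: "endH \<Rightarrow> endH \<Rightarrow> endH" is "\<lambda>S T v. S v + T v"
  by (simp add: linH_def scaleH_add_right algebra_simps)
lift_definition uminus_endH :: "endH \<Rightarrow> endH" is "\<lambda>S v. - S v"
  by (simp add: linH_def scaleH_uminus)
lift_definition minus_endH :: "endH \<Rightarrow> endH \<Rightarrow> endH" is "\<lambda>S T v. S v - T v"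
  by (simp add: linH_def scaleH_diff algebra_simps)
lift_definition times_endH :: "endH \<Rightarrow> endH \<Rightarrow> endH" is "\<lambda>S T v. S (T v)"
  by (simp add: linH_def)
instance
proof
  show "(0::endH) \<noteq> 1"
  proof
    assume "(0::endH) = 1"
    then have "(0 :: nat \<Rightarrow>\<^sub>0 mero) = Poly_Mapping.single 0 1" by transfer meson
    then show False by (metis lookup_single_eq lookup_zero zero_neq_one)
  qed
qed (transfer; force simp: linH_def algebra_simps)+
end

lift_definition scale_endH :: "complex \<Rightarrow> endH \<Rightarrow> endH" is "\<lambda>c T v. scaleH c (T v)"
  by (simp add: linH_def scaleH_add_right scaleH_scaleH mult.commute)

definition basis_op :: "(nat \<Rightarrow> mero \<Rightarrow> mero) \<Rightarrow> int \<Rightarrow> (nat \<Rightarrow>\<^sub>0 mero) \<Rightarrow> (nat \<Rightarrow>\<^sub>0 mero)" where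
  "basis_op \<phi> d v =
     (\<Sum>k\<in>Poly_Mapping.keys v. bvec (\<phi> k (Poly_Mapping.lookup v k)) (int k + d))"

lemma bvec_add: "bvec (f + g) k = bvec f k + bvec g k"
  by (simp add: bvec_def single_add)

lemma bvec_zero: "bvec 0 k = 0"
  by (simp add: bvec_def)

lemma bvec_scale: "bvec (mero_of (\<lambda>_. c) * f) k = scaleH c (bvec f k)"
  by (rule poly_mapping_eqI) (simp add: bvec_def lookup_scaleH lookup_single when_def)

context
  fixes \<phi> :: "nat \<Rightarrow> mero \<Rightarrow> mero"
  assumes add: "\<And>k f g. \<phi> k (f + g) = \<phi> k f + \<phi> k g"
    and const: "\<And>k c f. \<phi> k (mero_of (\<lambda>_. c) * f) = mero_of (\<lambda>_. c) * \<phi> k f"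
begin

lemma \<phi>_zero: "\<phi> k 0 = 0"
  using add[of k 0 0] by (metis add_0 add_cancel_right_right)

lemma basis_op_superset:
  assumes "finite K" "Poly_Mapping.keys v \<subseteq> K"
  shows "basis_op \<phi> d v = (\<Sum>k\<in>K. bvec (\<phi> k (Poly_Mapping.lookup v k)) (int k + d))"
  unfolding basis_op_def using assms
  by (intro sum.mono_neutral_left) (auto simp: in_keys_iff \<phi>_zero bvec_zero)

lemma scaleH_sum: "scaleH c (sum f K) = (\<Sum>k\<in>K. scaleH c (f k))"
  by (induction K rule: infinite_finite_induct) (simp_all add: scaleH_zero scaleH_add_right)

lemma basis_op_linear: "linH (basis_op \<phi> d)"
proof -
  have "basis_op \<phi> d (v + w) = basis_op \<phi> d v + basis_op \<phi> d w" for v w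
  proof -
    let ?K = "Poly_Mapping.keys v \<union> Poly_Mapping.keys w"
    have "Poly_Mapping.keys (v + w) \<subseteq> ?K" by (rule keys_add)
    then show ?thesis
      by (simp add: basis_op_superset[of ?K] lookup_add add bvec_add sum.distrib)
  qed
  moreover have "basis_op \<phi> d (scaleH c v) = scaleH c (basis_op \<phi> d v)" for c v
  proof -
    have "Poly_Mapping.keys (scaleH c v) \<subseteq> Poly_Mapping.keys v"
      by (auto simp: in_keys_iff lookup_scaleH)
    then show ?thesis
      by (simp add: basis_op_superset[of "Poly_Mapping.keys v"] lookup_scaleH const bvec_scale
          scaleH_sum)
  qed
  ultimately show ?thesis by (simp add: linH_def)
qed

lemma basis_op_bvec: "k \<ge> 0 \<Longrightarrow> basis_op \<phi> d (bvec g k) = bvec (\<phi> (nat k) g) (k + d)"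
  by (subst basis_op_superset[of "{nat k}"]) (auto simp: bvec_def lookup_single)

end

lemma dynamical_rep_exists:
  fixes p q :: real and \<omega> :: complex
  shows "\<exists>(sc :: complex \<Rightarrow> endH \<Rightarrow> endH) \<alpha> \<beta> \<gamma> \<delta> \<mu>\<^sub>l \<mu>\<^sub>r \<pi>.
           dynamical_rep sc p q \<omega> \<alpha> \<beta> \<gamma> \<delta> \<mu>\<^sub>l \<mu>\<^sub>r \<pi>"
proof -
  define op where "op F a d =
      Abs_endH (basis_op (\<lambda>k g. F (int k) * shift a g) d)" for F :: "int \<Rightarrow> mero" and a d
  have op: "apply_endH (op F a d) (bvec g k) = bvec (F k * shift a g) (k + d)" if "k \<ge> 0" for F a d g k
    unfolding op_def using that
    by (subst Abs_endH_inverse)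
       (auto simp: basis_op_linear basis_op_bvec shift_add shift_mult shift_const algebra_simps)
  have shift0: "shift 0 g = g" for g
    by transfer (simp add: mero_eq_def)
  have "dynamical_rep scale_endH p q \<omega>
     (\<lambda>z. op (\<lambda>k. mero_of (\<lambda>lam. coefA p q \<omega> k lam z)) (-1) 0)
     (\<lambda>z. op (\<lambda>k. mero_of (\<lambda>lam. coefB p q \<omega> k lam z)) 1 1)
     (\<lambda>z. op (\<lambda>k. mero_of (\<lambda>lam. coefC p q \<omega> k lam z)) (-1) (-1))
     (\<lambda>z. op (\<lambda>k. mero_of (\<lambda>lam. coefD p q \<omega> k lam z)) 1 0)
     (\<lambda>f. op (\<lambda>k. shift (2 * of_int k - \<omega>) f) 0 0)
     (\<lambda>f. op (\<lambda>k. f) 0 0) apply_endH"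
  proof (unfold_locales, goal_cases)
    case 5
    then show ?case by transfer (simp add: linH_def)
  next
    case 6
    then show ?case by transfer (simp add: linH_def)
  qed (simp_all add: op shift0,
      (transfer; force simp: linH_def scaleH_add_right scaleH_add_left scaleH_scaleH scaleH_one)+)
  then show ?thesis by blast
qed

end

theory Submission
  imports Defs
begin

text \<open>
  The sum over strings of generators and the terminating series agree term by term, so no
  summation or transformation formula for theta functions enters: after the generators have acted,
  the string with index \<open>l\<close> contributes exactly the \<open>l\<close>-th term of the series times the prefactor.

  Powers of \<open>q\<close> are the first obstacle. Put \<open>\<sigma>(x) = q\<^bsup>-x\<^esup> \<theta>(q\<^bsup>2x\<^esup>)\<close>, here \<open>odd_theta\<close>. The inversion
  \<open>\<theta>(1/x) = -\<theta>(x)/x\<close> says that \<open>\<sigma>\<close> is odd. Write \<open>z = q\<^bsup>2W+\<omega>-1\<^esup>\<close> and \<open>Z = W + \<omega>\<close>, so that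
  \<open>zq\<^bsup>\<omega>+1\<^esup> = q\<^bsup>2Z\<^esup>\<close> and \<open>zq\<^bsup>1-\<omega>\<^esup> = q\<^bsup>2W\<^esup>\<close>. Expressed by \<open>\<sigma>\<close>, the coefficients of the four generators, the
  product of the binomials with the function of \<open>\<mu>\<close>, and each term of the series together with its
  prefactor all carry the total power \<open>q\<^sup>0\<close> (\<open>coefA_odd_theta\<close> to \<open>coefD_odd_theta\<close>,
  \<open>tau_odd_theta\<close>). What remains are products of values of \<open>\<sigma>\<close> along arithmetic progressions of
  step 1, and elliptic factorials of negative length are inverses of such products.

  A generator maps \<open>g e\<^sub>n\<close> to a function times a translate of \<open>g\<close> times one basis vector; hence so does
  a string, and the translations turn its coefficient into such products (\<open>word_action\<close>,
  \<open>summand_action\<close>). The identity between single terms (\<open>tau_summand_eq_word_coef\<close>) splits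
  according to the class of the arguments modulo the integers. For the classes of \<open>\<lambda>\<close>, \<open>\<lambda> - \<omega>\<close>,
  \<open>W + \<lambda>\<close> and \<open>Z - \<lambda>\<close> all values of \<open>\<sigma>\<close> are nonzero for generic \<open>\<lambda>\<close>, so products over intervals
  are quotients of values of one function on the integers, and the claim is a cancellation. For the
  classes of \<open>0\<close>, \<open>\<omega>\<close>, \<open>W\<close> and \<open>Z\<close>, where \<open>\<sigma>\<close> may vanish, only adjacent intervals are joined; the
  divisions that occur there are justified by the multiplicative independence of \<open>p\<close> and \<open>q\<close> and by
  the condition on \<open>zq\<^bsup>2(m+k)-\<omega>+1\<^esup>\<close>. The terms of the series with \<open>s < k + j - N\<close>, to which no
  string corresponds, vanish because the compensated quotient contains \<open>\<sigma>(0)\<close>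
  (\<open>tau_summand_eq_0\<close>).

  The zeros of \<open>\<sigma>\<close> are countable, so the term-wise identity fails at most for countably many \<open>\<lambda>\<close>, and
  meromorphic functions that agree off a countable set represent the same field element
  (\<open>mero_of_eqI\<close>).
\<close>

section \<open>The theta function\<close>

text \<open>One bound serves convergence at a point and uniform convergence on compact sets.\<close>

lemma theta_factor_bound:
  fixes p R :: real and z :: complex
  assumes "0 < p" "p < 1" "norm z \<le> R" "norm (1 / z) \<le> R"
  shows "norm ((1 - z * of_real p ^ n) * (1 - of_real p ^ Suc n / z) - 1) \<le> (R + 1)^2 * p ^ n"
proof (cases "z = 0")
  case True
  then show ?thesis using assms by (auto simp: norm_power intro!: mult_mono)
next
  case False
  have R: "0 \<le> R" using assms(3) norm_ge_zero[of z] by linarith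
  have pn: "0 < p ^ n" "p ^ n \<le> 1" using assms by (auto intro: power_le_one)
  have "(1 - z * of_real p ^ n) * (1 - of_real p ^ Suc n / z) - 1 =
      - (z * of_real (p ^ n)) - 1 / z * of_real (p * p ^ n) + of_real (p * p ^ n * p ^ n)"
    using False by (simp add: field_simps)
  also have "norm \<dots> \<le> norm z * p ^ n + norm (1 / z) * (p * p ^ n) + p * p ^ n * p ^ n"
    using assms(1) pn
    by (intro norm_triangle_le norm_triangle_le_diff add_mono)
       (auto simp: norm_mult norm_divide norm_power)
  also have "\<dots> \<le> R * p ^ n + R * p ^ n + 1 * p ^ n"
  proof (intro add_mono)
    show "norm z * p ^ n \<le> R * p ^ n" using assms pn by (intro mult_right_mono) auto
    have "p * p ^ n \<le> 1 * p ^ n" using assms pn by (intro mult_right_mono) auto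
    then show "norm (1 / z) * (p * p ^ n) \<le> R * p ^ n"
      using assms pn R by (intro mult_mono) auto
    show "p * p ^ n * p ^ n \<le> 1 * p ^ n"
      using assms pn by (intro mult_right_mono mult_le_one) auto
  qed
  also have "\<dots> \<le> (R + 1)^2 * p ^ n"
  proof -
    have "0 \<le> R * R * p ^ n" using pn R by simp
    then show ?thesis by (simp add: power2_eq_square algebra_simps)
  qed
  finally show ?thesis .
qed

lemma theta_convergent:
  assumes "0 < p" "p < 1"
  shows "convergent_prod (\<lambda>j. (1 - z * of_real p ^ j) * (1 - of_real p ^ Suc j / z) :: complex)"
proof (rule abs_convergent_prod_imp_convergent_prod, rule summable_imp_abs_convergent_prod)
  define R where "R = max (norm z) (norm (1 / z))"
  show "summable (\<lambda>j. norm ((1 - z * of_real p ^ j) * (1 - of_real p ^ Suc j / z) - 1))"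
  proof (rule summable_comparison_test')
    show "summable (\<lambda>j. (R + 1)^2 * p ^ j)"
      using assms by (intro summable_mult summable_geometric) auto
    show "norm (norm ((1 - z * of_real p ^ j) * (1 - of_real p ^ Suc j / z) - 1)) \<le> (R + 1)^2 * p ^ j"
      if "j \<ge> 0" for j
      using theta_factor_bound[OF assms, of z R j] by (simp add: R_def)
  qed
qed

lemma theta_LIMSEQ:
  assumes "0 < p" "p < 1"
  shows "(\<lambda>n. \<Prod>j<n. (1 - z * of_real p ^ j) * (1 - of_real p ^ Suc j / z)) \<longlonglongrightarrow> theta p z"
  using convergent_prod_LIMSEQ[OF theta_convergent[OF assms, of z]]
  by (simp add: theta_def LIMSEQ_lessThan_iff_atMost)

lemma theta_eq_0_imp:
  assumes "0 < p" "p < 1" "z \<noteq> 0" "theta p z = 0"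
  shows "z \<in> powers_of p"
proof -
  obtain j where "(1 - z * of_real p ^ j) * (1 - of_real p ^ Suc j / z) = 0"
    using prodinf_nonzero[OF theta_convergent[OF assms(1,2), of z]] assms(4)
    unfolding theta_def by blast
  then consider "z * of_real p ^ j = 1" | "of_real p ^ Suc j = z"
    using assms(3) by auto
  then show ?thesis
  proof cases
    case 1
    then have "z = of_real p powi (- int j)"
      using assms(1) by (simp add: power_int_minus field_simps)
    then show ?thesis unfolding powers_of_def by blast
  next
    case 2
    then have "z = of_real p powi int (Suc j)"
      by (simp only: power_int_of_nat)
    then show ?thesis unfolding powers_of_def by blast
  qed
qed

lemma theta_one:
  assumes "0 < p" "p < 1"
  shows "theta p 1 = 0"
proof -
  have "(\<Prod>j<n. (1 - 1 * of_real p ^ j) * (1 - of_real p ^ Suc j / 1)) = (0::complex)" if "n \<ge> 1" for n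
    using that by (intro prod_zero) (auto intro: bexI[of _ 0])
  then have "(\<lambda>n. \<Prod>j<n. (1 - 1 * of_real p ^ j) * (1 - of_real p ^ Suc j / 1)) \<longlonglongrightarrow> (0::complex)"
    by (intro tendsto_eventually eventually_sequentiallyI[of 1]) auto
  then show ?thesis using theta_LIMSEQ[OF assms, of 1] LIMSEQ_unique by blast
qed

lemma theta_inverse:
  assumes p: "0 < p" "p < 1" and z: "z \<noteq> 0"
  shows "theta p (1 / z) = - theta p z / z"
proof -
  let ?P = "\<lambda>z n. \<Prod>j<n. (1 - z * of_real p ^ j) * (1 - of_real p ^ Suc j / z) :: complex"
  \<comment> \<open>The partial products at \<open>1 / z\<close> and \<open>z\<close> consist of the same factors, except for the first and
    the last one.\<close>
  have *: "?P (1 / z) n * (z - of_real p ^ n) = - (1 - z * of_real p ^ n) * ?P z n" for n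
  proof (induction n)
    case 0
    then show ?case by simp
  next
    case (Suc n)
    have "?P (1 / z) (Suc n) * (z - of_real p ^ Suc n) =
        (?P (1 / z) n * (z - of_real p ^ n)) * ((1 - of_real p ^ Suc n * z) * (1 - of_real p ^ Suc n / z))"
      using z by (simp add: field_simps)
    also have "\<dots> = - (1 - z * of_real p ^ Suc n) * ?P z (Suc n)"
      unfolding Suc.IH by (simp only: prod.lessThan_Suc mult_minus_left mult_minus_right mult_ac)
    finally show ?case .
  qed
  have p0: "(\<lambda>n. complex_of_real p ^ n) \<longlonglongrightarrow> 0"
    using p by (intro LIMSEQ_power_zero) auto
  have "(\<lambda>n. ?P (1 / z) n * (z - of_real p ^ n)) \<longlonglongrightarrow> theta p (1 / z) * (z - 0)"
    by (intro tendsto_intros theta_LIMSEQ p p0)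
  moreover have "(\<lambda>n. - (1 - z * of_real p ^ n) * ?P z n) \<longlonglongrightarrow> - (1 - z * 0) * theta p z"
    by (intro tendsto_intros theta_LIMSEQ p p0)
  ultimately have "theta p (1 / z) * (z - 0) = - (1 - z * 0) * theta p z"
    unfolding * using LIMSEQ_unique by blast
  then show ?thesis using z by (simp add: field_simps)
qed

lemma theta_holomorphic:
  assumes p: "0 < p" "p < 1"
  shows "theta p holomorphic_on - {0}"
proof (rule holomorphic_uniform_sequence)
  let ?P = "\<lambda>n z. \<Prod>j<n. (1 - z * of_real p ^ j) * (1 - of_real p ^ Suc j / z) :: complex"
  show "open (- {0::complex})" by auto
  show "?P n holomorphic_on - {0}" for n by (intro holomorphic_intros) auto
  fix x :: complex assume x: "x \<in> - {0}"
  then obtain d where d: "d > 0" "cball x d \<subseteq> - {0}"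
    using open_contains_cball[of "- {0::complex}"] by auto
  have "compact ((\<lambda>z. 1 / z) ` cball x d)"
    using d by (intro compact_continuous_image continuous_intros) auto
  from compact_imp_bounded[OF this] compact_imp_bounded[OF compact_cball[of x d]]
  obtain R1 R2 where "\<And>z. z \<in> cball x d \<Longrightarrow> norm (1 / z) \<le> R1" "\<And>z. z \<in> cball x d \<Longrightarrow> norm z \<le> R2"
    unfolding bounded_iff by blast
  then have R: "norm z \<le> max R1 R2" "norm (1 / z) \<le> max R1 R2" if "z \<in> cball x d" for z
    using that by force+
  have "uniformly_convergent_on (cball x d) ?P"
  proof (rule uniformly_convergent_on_prod')
    show "continuous_on (cball x d) (\<lambda>z. (1 - z * of_real p ^ j) * (1 - of_real p ^ Suc j / z))" for j
      using d by (intro continuous_intros) auto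
    show "uniformly_convergent_on (cball x d)
        (\<lambda>N z. \<Sum>n<N. norm ((1 - z * complex_of_real p ^ n) * (1 - complex_of_real p ^ Suc n / z) - 1))"
    proof (rule Weierstrass_m_test')
      show "summable (\<lambda>j. (max R1 R2 + 1)^2 * p ^ j)"
        using p by (intro summable_mult summable_geometric) auto
    qed (use theta_factor_bound[OF p R] in auto)
  qed auto
  then have "uniform_limit (cball x d) ?P (\<lambda>z. lim (\<lambda>n. ?P n z)) sequentially"
    by (simp add: uniformly_convergent_uniform_limit_iff)
  also have "?this \<longleftrightarrow> uniform_limit (cball x d) ?P (theta p) sequentially"
    by (simp only: limI[OF theta_LIMSEQ[OF p]])
  finally show "\<exists>d>0. cball x d \<subseteq> - {0} \<and> uniform_limit (cball x d) ?P (theta p) sequentially"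
    using d by blast
qed

section \<open>Products along arithmetic progressions\<close>

lemma qpow_0 [simp]: "qpow q 0 = 1"
  by (simp add: qpow_def)

lemma qpow_nonzero [simp]: "qpow q x \<noteq> 0"
  by (simp add: qpow_def)

lemma qpow_minus: "qpow q (- x) = 1 / qpow q x"
  by (simp add: qpow_def exp_minus field_simps)

lemma qpow_of_nat: "0 < q \<Longrightarrow> qpow q (of_nat n) = of_real (q ^ n)"
  by (simp add: qpow_def exp_of_nat_mult exp_of_real)

text \<open>The elliptic factorial with \<open>s(x + i)\<close> in place of \<open>\<theta>(aq\<^bsup>2i\<^esup>)\<close>. For negative \<open>n\<close> the product over
  \<open>n \<le> i < 0\<close> is inverted, so that the length is additive whenever nothing vanishes.\<close>

definition shifted_prod :: "(complex \<Rightarrow> complex) \<Rightarrow> complex \<Rightarrow> int \<Rightarrow> complex" where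
  "shifted_prod s x n =
     (if n \<ge> 0 then \<Prod>i\<in>{0..<n}. s (x + of_int i) else 1 / (\<Prod>i\<in>{n..<0}. s (x + of_int i)))"

lemma shifted_prod_0 [simp]: "shifted_prod s x 0 = 1"
  by (simp add: shifted_prod_def)

lemma shifted_prod_1 [simp]: "shifted_prod s x 1 = s x"
proof -
  have "{0..<1::int} = {0}" by auto
  then show ?thesis by (simp add: shifted_prod_def)
qed

text \<open>Joining two intervals of nonnegative length needs no division, so it is available also where
  \<open>s\<close> has zeros.\<close>

lemma shifted_prod_split:
  assumes "0 \<le> a" "0 \<le> b"
  shows "shifted_prod s x (a + b) = shifted_prod s x a * shifted_prod s (x + of_int a) b"
proof -
  let ?f = "\<lambda>i::int. s (x + of_int i)"
  have "prod ?f {0..<a + b} = prod ?f {0..<a} * prod ?f {a..<a + b}"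
    using assms by (subst prod.union_disjoint [symmetric]) (auto intro: arg_cong2[where f = prod])
  also have "prod ?f {a..<a + b} = (\<Prod>i\<in>{0..<b}. ?f (i + a))"
    by (rule prod.reindex_bij_witness[of _ "\<lambda>i. i + a" "\<lambda>i. i - a"]) auto
  finally show ?thesis
    using assms by (simp add: shifted_prod_def algebra_simps)
qed

lemma shifted_prod_nonzero:
  assumes "\<And>i. 0 \<le> i \<Longrightarrow> i < n \<Longrightarrow> s (x + of_int i) \<noteq> 0"
    and "\<And>i. n \<le> i \<Longrightarrow> i < 0 \<Longrightarrow> s (x + of_int i) \<noteq> 0"
  shows "shifted_prod s x n \<noteq> 0"
  using assms by (auto simp: shifted_prod_def)

text \<open>If \<open>s\<close> has no zeros in the class \<open>x + \<int>\<close>, every product over an interval in this class is a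
  quotient of two values of one function on the integers. This reduces identities between such
  products, of any sign of the lengths, to cancellation.\<close>

lemma shifted_prod_shift:
  assumes nz: "\<And>i::int. s (x + of_int i) \<noteq> 0"
  shows "shifted_prod s (x + of_int a) n = shifted_prod s x (a + n) / shifted_prod s x a"
proof -
  have step: "shifted_prod s y (i + 1) = shifted_prod s y i * s (y + of_int i)"
    if nz: "\<And>i::int. s (y + of_int i) \<noteq> 0" for y i
  proof (cases "i \<ge> 0")
    case True
    then show ?thesis using shifted_prod_split[of i 1 s y] by simp
  next
    case False
    then have "{i..<0} = insert i {i + 1..<0}" by auto
    then show ?thesis using False nz[of i] by (auto simp: shifted_prod_def)
  qed
  have nz0: "shifted_prod s x i \<noteq> 0" for i
    by (intro shifted_prod_nonzero nz)
  have nza: "s (x + of_int a + of_int i) \<noteq> 0" for i :: int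
    using nz[of "a + i"] by (simp add: add.assoc)
  have "shifted_prod s (x + of_int a) n * shifted_prod s x a = shifted_prod s x (a + n)"
  proof (induction n rule: int_induct[where k = 0])
    case base
    show ?case by simp
  next
    case (step1 i)
    then show ?case
      using step[OF nza, of i] step[OF nz, of "a + i"] by (simp add: algebra_simps)
  next
    case (step2 i)
    then show ?case
      using step[OF nza, of "i - 1"] step[OF nz, of "a + (i - 1)"] nz[of "a + (i - 1)"]
      by (simp add: algebra_simps)
  qed
  then show ?thesis using nz0[of a] by (simp add: field_simps)
qed

lemma shifted_prod_reflect:
  assumes odd: "\<And>y. s (- y) = - s y"
  shows "shifted_prod s (- x) n = (- 1) powi n * shifted_prod s (x - of_int n + 1) n"
proof (cases "n \<ge> 0")
  case True
  have "(\<Prod>i\<in>{0..<n}. s (- x + of_int i)) = (\<Prod>i\<in>{0..<n}. - s (x - of_int n + 1 + of_int (n - 1 - i)))"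
    by (intro prod.cong refl) (simp add: odd[symmetric])
  also have "\<dots> = (- 1) ^ nat n * (\<Prod>i\<in>{0..<n}. s (x - of_int n + 1 + of_int (n - 1 - i)))"
    using prod.distrib[of "\<lambda>_. - 1" "\<lambda>i. s (x - of_int n + 1 + of_int (n - 1 - i))" "{0..<n}"] by simp
  also have "(\<Prod>i\<in>{0..<n}. s (x - of_int n + 1 + of_int (n - 1 - i))) =
      (\<Prod>i\<in>{0..<n}. s (x - of_int n + 1 + of_int i))"
    by (rule prod.reindex_bij_witness[of _ "\<lambda>i. n - 1 - i" "\<lambda>i. n - 1 - i"]) auto
  finally show ?thesis using True by (simp add: shifted_prod_def power_int_def)
next
  case False
  have "(\<Prod>i\<in>{n..<0}. s (- x + of_int i)) = (\<Prod>i\<in>{n..<0}. - s (x - of_int n + 1 + of_int (n - 1 - i)))"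
    by (intro prod.cong refl) (simp add: odd[symmetric])
  also have "\<dots> = (- 1) ^ nat (- n) * (\<Prod>i\<in>{n..<0}. s (x - of_int n + 1 + of_int (n - 1 - i)))"
    using prod.distrib[of "\<lambda>_. - 1" "\<lambda>i. s (x - of_int n + 1 + of_int (n - 1 - i))" "{n..<0}"] by simp
  also have "(\<Prod>i\<in>{n..<0}. s (x - of_int n + 1 + of_int (n - 1 - i))) =
      (\<Prod>i\<in>{n..<0}. s (x - of_int n + 1 + of_int i))"
    by (rule prod.reindex_bij_witness[of _ "\<lambda>i. n - 1 - i" "\<lambda>i. n - 1 - i"]) auto
  finally show ?thesis using False
    by (cases "even (nat (- n))") (simp_all add: shifted_prod_def power_int_def)
qed

lemma minus_one_powi_mult_self: "(- 1 :: complex) powi n * (- 1) powi n = 1"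
  by (cases "even n") auto

section \<open>The odd theta function\<close>

text \<open>The normalization of the theta function in additive notation that is odd.\<close>

definition odd_theta :: "real \<Rightarrow> real \<Rightarrow> complex \<Rightarrow> complex" where
  "odd_theta p q x = qpow q (- x) * theta p (qpow q (2 * x))"

lemma theta_eq_odd_theta: "theta p (qpow q (2 * x)) = qpow q x * odd_theta p q x"
  by (simp add: odd_theta_def qpow_minus)

lemma sum_progression: "n \<ge> 0 \<Longrightarrow> (\<Sum>i\<in>{0..<n}. x + of_int i) = of_int n * x + of_int (n * (n - 1)) / (2::complex)"
proof (induction n rule: int_ge_induct)
  case (step i)
  then have "{0..<i + 1} = insert i {0..<i}" by auto
  then show ?case using step by (simp add: field_simps)
qed simp

lemma qpow_sum: "finite A \<Longrightarrow> qpow q (sum f A) = (\<Prod>i\<in>A. qpow q (f i))"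
  by (induction A rule: finite_induct) (simp_all add: qpow_add)

lemma tfact_eq_shifted_prod:
  "tfact p q (qpow q (2 * x)) n =
     qpow q (of_int n * x + of_int (n * (n - 1)) / 2) * shifted_prod (odd_theta p q) x n"
proof (cases "n \<ge> 0")
  case True
  have *: "theta p (qpow q (2 * x) * qpow q (2 * of_int i)) = qpow q (x + of_int i) * odd_theta p q (x + of_int i)" for i
    using theta_eq_odd_theta[of p q "x + of_int i"] by (simp only: distrib_left[of 2] qpow_add)
  have "tfact p q (qpow q (2 * x)) n = (\<Prod>i\<in>{0..<n}. qpow q (x + of_int i) * odd_theta p q (x + of_int i))"
    using True by (simp add: tfact_def *)
  also have "\<dots> = qpow q (\<Sum>i\<in>{0..<n}. x + of_int i) * shifted_prod (odd_theta p q) x n"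
    using True by (simp add: prod.distrib qpow_sum shifted_prod_def)
  finally show ?thesis using True by (simp add: sum_progression)
next
  case False
  have *: "theta p (qpow q (2 * x) * qpow q (2 * of_int n) * qpow q (2 * of_int i)) =
      qpow q (x + of_int n + of_int i) * odd_theta p q (x + of_int n + of_int i)" for i
    using theta_eq_odd_theta[of p q "x + of_int n + of_int i"] by (simp only: distrib_left[of 2] qpow_add)
  have "tfact p q (qpow q (2 * x)) n =
      1 / (\<Prod>i\<in>{0..<-n}. qpow q (x + of_int n + of_int i) * odd_theta p q (x + of_int n + of_int i))"
    using False by (simp add: tfact_def *)
  also have "\<dots> = 1 / qpow q (\<Sum>i\<in>{0..<-n}. x + of_int n + of_int i) *
      (1 / (\<Prod>i\<in>{0..<-n}. odd_theta p q (x + of_int n + of_int i)))"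
    by (simp add: prod.distrib qpow_sum)
  also have "(\<Prod>i\<in>{0..<-n}. odd_theta p q (x + of_int n + of_int i)) = (\<Prod>i\<in>{n..<0}. odd_theta p q (x + of_int i))"
    by (rule prod.reindex_bij_witness[of _ "\<lambda>i. i - n" "\<lambda>i. i + n"]) (auto simp: add_ac)
  also have "(\<Sum>i\<in>{0..<-n}. x + of_int n + of_int i) = - (of_int n * x + of_int (n * (n - 1)) / 2)"
    using False by (subst sum_progression) (auto simp: field_simps)
  finally show ?thesis
    unfolding qpow_minus using False by (simp add: shifted_prod_def)
qed

context
  fixes p q :: real
  assumes p: "0 < p" "p < 1" and q: "0 < q" "q < 1"
begin

lemma odd_theta_minus: "odd_theta p q (- x) = - odd_theta p q x"
proof -
  have "theta p (1 / qpow q (2 * x)) = - theta p (qpow q (2 * x)) / qpow q (2 * x)"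
    by (rule theta_inverse[OF p]) simp
  moreover have "qpow q (2 * x) = qpow q x * qpow q x"
    by (simp flip: qpow_add)
  ultimately show ?thesis
    by (simp add: odd_theta_def qpow_minus field_simps)
qed

lemma odd_theta_0 [simp]: "odd_theta p q 0 = 0"
  by (simp add: odd_theta_def theta_one[OF p])

lemma odd_theta_eq_0_imp: "odd_theta p q x = 0 \<Longrightarrow> qpow q (2 * x) \<in> powers_of p"
  using theta_eq_0_imp[OF p, of "qpow q (2 * x)"] by (simp add: odd_theta_def)

lemma odd_theta_analytic:
  assumes "f analytic_on A"
  shows "(\<lambda>x. odd_theta p q (f x)) analytic_on A"
proof -
  have "theta p analytic_on - {0}"
    using theta_holomorphic[OF p] by (simp add: analytic_on_open open_Compl)
  then have *: "(theta p \<circ> (\<lambda>x. qpow q (2 * f x))) analytic_on A"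
    unfolding qpow_def using assms
    by (intro analytic_on_compose_gen[of _ _ _ "- {0}"] analytic_intros) auto
  show ?thesis
    unfolding odd_theta_def qpow_def using assms *
    by (auto simp: o_def qpow_def intro!: analytic_intros)
qed

lemma shifted_prod_odd_theta_meromorphic:
  assumes "f analytic_on UNIV"
  shows "(\<lambda>x. shifted_prod (odd_theta p q) (f x) n) meromorphic_on UNIV"
proof -
  have *: "(\<lambda>x. odd_theta p q (f x + of_int i)) meromorphic_on UNIV" for i
    using assms by (intro analytic_on_imp_meromorphic_on odd_theta_analytic analytic_intros)
  show ?thesis
    by (cases "n \<ge> 0") (auto simp: shifted_prod_def intro!: meromorphic_intros *)
qed

lemma countable_odd_theta_zeros: "countable {x. odd_theta p q x = 0}"
proof (rule countable_subset)
  let ?f = "\<lambda>(m::int, r::int). (of_int m * of_real (ln p) + of_int (2 * r) * of_real pi * \<i>) / (2 * of_real (ln q))"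
  show "countable (range ?f)" by (rule countable_image) simp
  show "{x. odd_theta p q x = 0} \<subseteq> range ?f"
  proof
    fix x assume "x \<in> {x. odd_theta p q x = 0}"
    then obtain m :: int where "qpow q (2 * x) = of_real p powi m"
      using odd_theta_eq_0_imp unfolding powers_of_def by blast
    moreover have "of_real p powi m = exp (of_int m * of_real (ln p) :: complex)"
      using p by (simp add: exp_power_int exp_of_real mult.commute flip: exp_power_int)
    ultimately have "exp (2 * x * of_real (ln q)) = exp (of_int m * of_real (ln p))"
      by (simp add: qpow_def)
    then obtain r :: int where
      "2 * x * of_real (ln q) = of_int m * of_real (ln p) + of_int (2 * r) * of_real pi * \<i>"
      using exp_eq by force
    moreover have "ln q \<noteq> 0" using q by simp
    ultimately have "x = ?f (m, r)" by (simp add: field_simps)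
    then show "x \<in> range ?f" by (rule range_eqI)
  qed
qed

text \<open>The values of \<open>x\<close> with a zero in the class of \<open>a x + c\<close> modulo \<open>\<int>\<close> may accumulate,
  because the numbers \<open>p\<^sup>m q\<^sup>n\<close> can be dense in the positive reals. They form a countable set, but in
  general not a discrete one.\<close>

lemma countable_not_generic:
  assumes "a \<noteq> 0"
  shows "countable {x. \<exists>i::int. odd_theta p q (a * x + c + of_int i) = 0}"
proof -
  have "{x. \<exists>i::int. odd_theta p q (a * x + c + of_int i) = 0} \<subseteq>
      (\<Union>i::int. (\<lambda>y. (y - c - of_int i) / a) ` {y. odd_theta p q y = 0})"
  proof
    fix x assume "x \<in> {x. \<exists>i::int. odd_theta p q (a * x + c + of_int i) = 0}"
    then obtain i :: int where "odd_theta p q (a * x + c + of_int i) = 0" by blast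
    moreover have "x = ((a * x + c + of_int i) - c - of_int i) / a" using assms by simp
    ultimately show "x \<in> (\<Union>i::int. (\<lambda>y. (y - c - of_int i) / a) ` {y. odd_theta p q y = 0})" by blast
  qed
  then show ?thesis
    by (rule countable_subset) (use countable_odd_theta_zeros in simp)
qed

text \<open>The polynomial \<open>Y\<^sup>n - X\<^sup>m\<close> does not vanish at \<open>(p, q)\<close>.\<close>

lemma q_power_noteq_p_power:
  assumes "algebraically_independent2 p q" and n: "n > 0"
  shows "q ^ n \<noteq> p ^ m"
proof
  assume eq: "q ^ n = p ^ m"
  define P :: "rat poly poly" where "P = monom 1 n - [:monom 1 m:]"
  let ?h = "\<lambda>c. poly (map_poly of_rat c) p"
  have hd: "?h (a - b) = ?h a - ?h b" for a b
  proof -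
    have "map_poly of_rat (a - b) = map_poly of_rat a - (map_poly of_rat b :: real poly)"
      by (rule poly_eqI) (simp add: coeff_map_poly of_rat_diff)
    then show ?thesis by simp
  qed
  have "map_poly ?h P = map_poly ?h (monom 1 n) - map_poly ?h [:monom 1 m:]"
    unfolding P_def by (rule poly_eqI) (simp add: coeff_map_poly hd)
  also have "\<dots> = monom 1 n - [:p ^ m:]"
    by (simp add: map_poly_monom poly_monom map_poly_pCons)
  finally have "poly (map_poly ?h P) q = q ^ n - p ^ m" by (simp add: poly_monom)
  moreover have "P \<noteq> 0"
  proof
    assume "P = 0"
    then have "coeff P n = 0" by simp
    with n show False unfolding P_def by (simp add: coeff_pCons split: nat.splits)
  qed
  ultimately show False using assms(1) eq unfolding algebraically_independent2_def by auto
qed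

text \<open>A zero at \<open>n\<close> means \<open>q\<^bsup>2n\<^esup> = p\<^sup>i\<close> for an integer \<open>i\<close>. By oddness \<open>n > 0\<close> can be assumed; then the
  left side is smaller than 1, which excludes negative \<open>i\<close>.\<close>

lemma odd_theta_of_int_nonzero:
  assumes ai: "algebraically_independent2 p q" and "n \<noteq> 0"
  shows "odd_theta p q (of_int n) \<noteq> 0"
proof -
  have pos: "odd_theta p q (of_nat n) \<noteq> 0" if n: "n > 0" for n :: nat
  proof
    assume "odd_theta p q (of_nat n) = 0"
    from odd_theta_eq_0_imp[OF this] obtain m :: int where "qpow q (of_nat (2 * n)) = of_real p powi m"
      unfolding powers_of_def by auto
    then have "complex_of_real (q ^ (2 * n)) = of_real (p powi m)"
      unfolding qpow_of_nat[OF q(1)] by simp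
    then have eq: "q ^ (2 * n) = p powi m" by (simp only: of_real_eq_iff)
    show False
    proof (cases "m \<ge> 0")
      case True
      then show False using q_power_noteq_p_power[OF ai, of "2 * n" "nat m"] n eq
        by (simp add: power_int_def)
    next
      case False
      have "p powi m > 1" using False p
        by (simp add: power_int_def one_less_inverse power_Suc_less_one)
      moreover have "q ^ (2 * n) < 1" using q n power_strict_decreasing[of 0 "2 * n" q] by simp
      ultimately show False using eq by simp
    qed
  qed
  show ?thesis
  proof (cases "n > 0")
    case True
    then show ?thesis using pos[of "nat n"] by simp
  next
    case False
    then show ?thesis using pos[of "nat (- n)"] assms(2) by (simp add: odd_theta_minus)
  qed
qed

end

section \<open>The identity between single terms\<close>

text \<open>The coefficient with which the string with index \<open>l\<close> acts on \<open>g e\<^sub>m\<close>, with \<open>r\<close> factors \<open>\<delta>\<close>. Its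
  groups are the two binomials, the function of \<open>\<mu>\<close>, and the contributions of the generators
  \<open>\<gamma>\<close>, \<open>\<delta>\<close>, \<open>\<alpha>\<close>, \<open>\<beta>\<close> in this order.\<close>

definition word_coef ::
  "(complex \<Rightarrow> complex) \<Rightarrow> int \<Rightarrow> int \<Rightarrow> int \<Rightarrow> int \<Rightarrow> int \<Rightarrow> complex \<Rightarrow> complex \<Rightarrow> complex \<Rightarrow> complex" where
  "word_coef s N k j l m \<omega> W lam =
     (let P = shifted_prod s; Z = W + \<omega>; r = N - k - j + l in
      (P (of_int (k - l + 1)) l / P 1 l) * (P (of_int (N - k - j + l + 1)) (j - l) / P 1 (j - l))
      * (P (lam + of_int (N - k - 2*j + l + 2)) l / P (lam + of_int (N - 2*j + 2)) l
         * (P (lam + of_int (l - j + 2)) (j - l) / P (lam + of_int (N - 2*j - k + 2*l + 2)) (j - l)))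
      * (P (of_int (m + k - j + 1)) (j - l) * P (\<omega> + of_int (l - m - k + 1)) (j - l)
           * P (W + lam + of_int (N + m - 2*j + l + 1)) (j - l)
         / (s 1 powi (j - l) * P (lam + of_int (l - j + 2)) (j - l) * P (Z + of_int (N - k - j + l)) (j - l)))
      * (P (lam - \<omega> + of_int (m + k - j + 1)) r * P (W + of_int (m + k - l)) r
         / (P (lam + of_int (l - j + 1)) r * P Z r))
      * (P (lam + of_int (N - 2*j + m + 2)) l * P (Z + of_int (N - m - k)) l
         / (P (lam + of_int (N - k - 2*j + l + 2)) l * P (Z + of_int (N - l)) l))
      * ((- s 1) powi (k - l) * P (Z - lam + of_int (2*j - m - k - 1)) (k - l)
         / (P (lam + of_int (N - k - 2*j + l + 1)) (k - l) * P (Z + of_int (N - k)) (k - l))))"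

text \<open>What is left of \<open>\<tau>\<close> without powers of \<open>q\<close>: the factor in front of the series, and the \<open>l\<close>-th
  term of the series with the two compensated factorials included.\<close>

definition tau_prefactor ::
  "(complex \<Rightarrow> complex) \<Rightarrow> int \<Rightarrow> int \<Rightarrow> int \<Rightarrow> int \<Rightarrow> complex \<Rightarrow> complex \<Rightarrow> complex \<Rightarrow> complex" where
  "tau_prefactor s N k j m \<omega> W lam =
     (let P = shifted_prod s; Z = W + \<omega> in
      (- 1) powi (N - k) * s 1 powi (k - j)
      * (P (- (lam + of_int 1)) j * P (of_int (m + k - j + 1)) j * P (W + lam + of_int (N - 2*j + m + 1)) j
         / (P 1 j * P (lam + of_int (N - k - 2*j + 2)) j * P (lam + of_int (2 - j)) j))
      * (P (Z - lam + of_int (2*j - m - k - 1)) k / P (- (lam + of_int (N - 2*j))) k)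
      * (P (- (lam - \<omega> + of_int (N - 2*j + m))) (N - k - j) * P (W + of_int (m + k)) (N - k - j)
         / P (lam + of_int (1 - j)) (N - k - j))
      * (1 / P Z N))"

definition tau_summand ::
  "(complex \<Rightarrow> complex) \<Rightarrow> int \<Rightarrow> int \<Rightarrow> int \<Rightarrow> int \<Rightarrow> int \<Rightarrow> complex \<Rightarrow> complex \<Rightarrow> complex \<Rightarrow> complex" where
  "tau_summand s N k j l m \<omega> W lam =
     (let P = shifted_prod s; Z = W + \<omega> in
      s (lam + of_int (N - 2*j - k + 1 + 2*l)) / s (lam + of_int (N - 2*j - k + 1))
      * (P (lam + of_int (N - 2*j - k + 1)) l * P (- of_int k) l * P (- of_int j) l
         * P (lam + of_int (N + 2 + m - 2*j)) l * P (Z + of_int (N - m - k)) l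
         * P (- (W + of_int (m + k - 1))) l * P (lam + of_int (1 - j)) l
         * P (lam - \<omega> + of_int (N - 2*j + m + 1)) l)
      / (P 1 l * P (lam + of_int (N - 2*j + 2)) l * P (lam + of_int (N - j - k + 2)) l
         * P (- of_int (m + k)) l * P (- (Z - lam + of_int (2*j - m - 2))) l
         * P (W + lam + of_int (N - 2*j + m + 1)) l)
      * (P (of_int (N - k - j + 1 + l)) (j - l) * P (\<omega> + of_int (l - m - k + 1)) (j - l)))"

locale odd_function =
  fixes s :: "complex \<Rightarrow> complex"
  assumes odd: "s (- x) = - s x"
begin

abbreviation "P \<equiv> shifted_prod s"
abbreviation alt :: "int \<Rightarrow> complex" where "alt n \<equiv> (- 1) powi n"

lemma reflect: "P (- x) n = alt n * P (x - of_int n + 1) n"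
  by (rule shifted_prod_reflect) (rule odd)

text \<open>The equations for the second base point and the length are premises, so that the integer
  arithmetic is left to the simplifier.\<close>

lemma split: "0 \<le> a \<Longrightarrow> 0 \<le> b \<Longrightarrow> y = x + of_int a \<Longrightarrow> c = a + b \<Longrightarrow> P x c = P x a * P y b"
  using shifted_prod_split by simp

text \<open>The class of \<open>0\<close>. Reflection turns the three factorials with negative arguments into products
  over positive integers. The range \<open>l \<le> k\<close>, \<open>l \<le> j\<close> keeps \<open>0\<close> out of every interval that is
  cancelled, while the factorials with \<open>m + k - j\<close> and \<open>N - k - j\<close> may vanish and are only split.\<close>

lemma integer_factors:
  assumes s_int: "\<And>n::int. n \<noteq> 0 \<Longrightarrow> s (of_int n) \<noteq> 0"
    and "0 \<le> l" "l \<le> k" "l \<le> j" "0 \<le> m"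
  shows "P (of_int (m + k - j + 1)) j / P 1 j * (P (- of_int k) l * P (- of_int j) l)
      / (P 1 l * P (- of_int (m + k)) l) * P (of_int (N - k - j + 1 + l)) (j - l)
    = alt l * (P (of_int (k - l + 1)) l / P 1 l) * (P (of_int (N - k - j + l + 1)) (j - l) / P 1 (j - l))
      * P (of_int (m + k - j + 1)) (j - l)"
proof -
  have nz: "P (of_int i) l \<noteq> 0" "P 1 l \<noteq> 0" "P 1 (j - l) \<noteq> 0" if "i > 0" for i
  proof -
    have "P (of_int i) n \<noteq> 0" if "i > 0" "n \<ge> 0" for i n
      using that s_int[of "i + _"] by (intro shifted_prod_nonzero) auto
    from this[of i l] this[of 1] that assms show "P (of_int i) l \<noteq> 0" "P 1 l \<noteq> 0" "P 1 (j - l) \<noteq> 0"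
      by auto
  qed
  have "P (of_int (m + k - j + 1)) j = P (of_int (m + k - j + 1)) (j - l) * P (of_int (m + k - l + 1)) l"
    by (rule split) (use assms in auto)
  moreover have "P 1 j = P 1 (j - l) * P (of_int (j - l + 1)) l"
    by (rule split) (use assms in auto)
  moreover have "P (- of_int k) l = alt l * P (of_int (k - l + 1)) l"
    "P (- of_int j) l = alt l * P (of_int (j - l + 1)) l"
    "P (- of_int (m + k)) l = alt l * P (of_int (m + k - l + 1)) l"
    using reflect[of "of_int k" l] reflect[of "of_int j" l] reflect[of "of_int (m + k)" l]
    by (simp_all add: algebra_simps)
  ultimately show ?thesis
    using nz[of "j - l + 1"] nz[of "m + k - l + 1"] assms by (simp add: divide_simps add_ac)
qed

text \<open>The class of \<open>W\<close>: the interval of length \<open>l\<close> ends where the one of length \<open>N - k - j\<close> begins. If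
  the latter length is negative, it removes the upper part of the former, which is where the
  assumption on zeros is needed.\<close>

lemma W_factors:
  assumes "0 \<le> l" "k + j - N \<le> l"
    and nz: "\<And>i. N - k - j \<le> i \<Longrightarrow> i < 0 \<Longrightarrow> s (W + of_int (m + k) + of_int i) \<noteq> 0"
  shows "P (W + of_int (m + k)) (N - k - j) * P (- (W + of_int (m + k - 1))) l
    = alt l * P (W + of_int (m + k - l)) (N - k - j + l)"
proof -
  have refl: "P (- (W + of_int (m + k - 1))) l = alt l * P (W + of_int (m + k - l)) l"
    using reflect[of "W + of_int (m + k - 1)" l] by (simp add: algebra_simps)
  have "P (W + of_int (m + k)) (N - k - j) * P (W + of_int (m + k - l)) l = P (W + of_int (m + k - l)) (N - k - j + l)"
  proof (cases "N - k - j \<ge> 0")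
    case True
    have "P (W + of_int (m + k - l)) (N - k - j + l) = P (W + of_int (m + k - l)) l * P (W + of_int (m + k)) (N - k - j)"
      by (rule split) (use assms True in auto)
    then show ?thesis by simp
  next
    case False
    define n where "n = k + j - N"
    have n: "n > 0" "N - k - j = - n" "n \<le> l" using False assms by (auto simp: n_def)
    have "P (W + of_int (m + k - l)) l = P (W + of_int (m + k - l)) (l - n) * P (W + of_int (m + k - n)) n"
      by (rule split) (use n in auto)
    moreover have "P (W + of_int (m + k)) (- n) * P (W + of_int (m + k - n)) n = 1"
    proof -
      have "(\<Prod>i\<in>{0..<n}. s (W + of_int (m + k - n) + of_int i)) = (\<Prod>i\<in>{-n..<0}. s (W + of_int (m + k) + of_int i))"
        by (rule prod.reindex_bij_witness[of _ "\<lambda>i. i + n" "\<lambda>i. i - n"]) (auto simp: algebra_simps)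
      moreover have "(\<Prod>i\<in>{-n..<0}. s (W + of_int (m + k) + of_int i)) \<noteq> 0"
        using nz n by auto
      ultimately show ?thesis using n by (simp add: shifted_prod_def)
    qed
    ultimately show ?thesis using n by (simp add: mult_ac)
  qed
  then show ?thesis using refl by simp
qed

text \<open>The class of \<open>Z\<close>: the denominators of the generators in a string fill the interval of length
  \<open>N\<close> without gaps, because the spectral parameters of the string run through
  \<open>q\<^bsup>2i\<^esup>z\<close> for \<open>0 \<le> i < N\<close>, each once.\<close>

lemma Z_factors:
  assumes "0 \<le> l" "k + j - N \<le> l" "l \<le> j" "l \<le> k"
  shows "P Z (N - k - j + l) * P (Z + of_int (N - k - j + l)) (j - l) * P (Z + of_int (N - k)) (k - l)
      * P (Z + of_int (N - l)) l = P Z N"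
proof -
  have "P Z N = P Z (N - l) * P (Z + of_int (N - l)) l" by (rule split) (use assms in auto)
  moreover have "P Z (N - l) = P Z (N - k) * P (Z + of_int (N - k)) (k - l)" by (rule split) (use assms in auto)
  moreover have "P Z (N - k) = P Z (N - k - j + l) * P (Z + of_int (N - k - j + l)) (j - l)"
    by (rule split) (use assms in auto)
  ultimately show ?thesis by simp
qed

text \<open>The next three lemmas serve the classes of \<open>W + \<lambda>\<close>, \<open>Z - \<lambda>\<close> and \<open>\<lambda> - \<omega>\<close>.\<close>

lemma ratio_at_generic_base:
  assumes "0 \<le> l" "l \<le> j" and nz: "\<And>i::int. s (X + of_int i) \<noteq> 0"
  shows "P (X + of_int a) j / P (X + of_int a) l = P (X + of_int (a + l)) (j - l)"
proof -
  have "P (X + of_int a) j = P (X + of_int a) l * P (X + of_int (a + l)) (j - l)"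
    by (rule split) (use assms in auto)
  moreover have "P (X + of_int a) l \<noteq> 0"
    using nz[of "a + _"] by (intro shifted_prod_nonzero) (simp_all add: add_ac)
  ultimately show ?thesis by simp
qed

lemma reflected_ratio_at_generic_base:
  assumes "0 \<le> l" "l \<le> k" and nz: "\<And>i::int. s (Y + of_int i) \<noteq> 0"
  shows "P (Y + of_int (b - k + 1)) k / P (- (Y + of_int b)) l = alt l * P (Y + of_int (b - k + 1)) (k - l)"
proof -
  have "P (Y + of_int (b - k + 1)) k = P (Y + of_int (b - k + 1)) (k - l) * P (Y + of_int (b - l + 1)) l"
    by (rule split) (use assms in auto)
  moreover have "P (Y + of_int (b - l + 1)) l \<noteq> 0"
    using nz[of "b - l + 1 + _"] by (intro shifted_prod_nonzero) (simp_all add: add_ac)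
  moreover have "P (- (Y + of_int b)) l = alt l * P (Y + of_int (b - l + 1)) l"
    using reflect[of "Y + of_int b" l] by (simp add: algebra_simps)
  ultimately show ?thesis by (simp add: divide_simps minus_one_powi_mult_self)
qed

lemma reflected_join_at_generic_base:
  assumes nz: "\<And>i::int. s (V + of_int i) \<noteq> 0"
  shows "P (- (V + of_int b)) n * P (V + of_int (b + 1)) l = alt n * P (V + of_int (b - n + 1)) (n + l)"
proof -
  have F0: "P V i \<noteq> 0" for i
    by (intro shifted_prod_nonzero nz)
  have "P (- (V + of_int b)) n = alt n * P (V + of_int (b - n + 1)) n"
    using reflect[of "V + of_int b" n] by (simp add: algebra_simps)
  then show ?thesis
    unfolding shifted_prod_shift[of s V, OF nz] using F0 by (simp add: field_simps)
qed

text \<open>The class of \<open>\<lambda>\<close>, which contains the very-well-poised part of the series. With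
  \<open>F n = P \<lambda> n\<close> all factors are quotients of values of \<open>F\<close>.\<close>

lemma lam_factors:
  assumes nz: "\<And>i::int. s (lam + of_int i) \<noteq> 0"
  shows "P (- (lam + of_int 1)) j / (P (lam + of_int (N - k - 2*j + 2)) j * P (lam + of_int (2 - j)) j)
      / P (- (lam + of_int (N - 2*j))) k / P (lam + of_int (1 - j)) (N - k - j)
      * (s (lam + of_int (N - 2*j - k + 1 + 2*l)) / s (lam + of_int (N - 2*j - k + 1)))
      * (P (lam + of_int (N - 2*j - k + 1)) l * P (lam + of_int (N + 2 + m - 2*j)) l * P (lam + of_int (1 - j)) l)
      / (P (lam + of_int (N - 2*j + 2)) l * P (lam + of_int (N - j - k + 2)) l)
    = alt j * alt k * (P (lam + of_int (N - k - 2*j + l + 2)) l / P (lam + of_int (N - 2*j + 2)) l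
         * (P (lam + of_int (l - j + 2)) (j - l) / P (lam + of_int (N - 2*j - k + 2*l + 2)) (j - l)))
      / P (lam + of_int (l - j + 2)) (j - l) / P (lam + of_int (l - j + 1)) (N - k - j + l)
      * P (lam + of_int (N - 2*j + m + 2)) l / P (lam + of_int (N - k - 2*j + l + 2)) l
      / P (lam + of_int (N - k - 2*j + l + 1)) (k - l)"
proof -
  define F where "F = P lam"
  have F0: "F i \<noteq> 0" for i
    unfolding F_def by (intro shifted_prod_nonzero nz)
  have PF: "P (lam + of_int a) n = F (a + n) / F a" for a n
    unfolding F_def by (rule shifted_prod_shift) (rule nz)
  have sF: "s (lam + of_int a) = F (a + 1) / F a" for a
    using PF[of a 1] by simp
  have rF: "P (- (lam + of_int a)) n = alt n * (F (a + 1) / F (a - n + 1))" for a n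
  proof -
    have "P (- (lam + of_int a)) n = alt n * P (lam + of_int (a - n + 1)) n"
      using reflect[of "lam + of_int a" n] by (simp add: algebra_simps)
    also have "\<dots> = alt n * (F (a + 1) / F (a - n + 1))"
      unfolding PF by simp
    finally show ?thesis .
  qed
  have sg: "inverse (alt k) = alt k" by (cases "even k") auto
  show ?thesis
    unfolding PF sF rF using F0 by (simp add: field_simps sg minus_one_powi_mult_self)
qed

text \<open>The factors are sorted by classes modulo \<open>\<int>\<close>. The reflections contribute a sign
  of parity \<open>l\<close> from each of the classes of \<open>0\<close>, \<open>W\<close> and \<open>Z - \<lambda>\<close>, one of parity \<open>N - k - j\<close> from that of
  \<open>\<lambda> - \<omega>\<close>, and those of parities \<open>j\<close> and \<open>k\<close> from that of \<open>\<lambda>\<close>. With the sign of the prefactor they give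
  the sign in the action of \<open>k - l\<close> factors \<open>\<beta>\<close>.\<close>

lemma tau_summand_eq_word_coef:
  assumes s_int: "\<And>n::int. n \<noteq> 0 \<Longrightarrow> s (of_int n) \<noteq> 0"
    and l: "0 \<le> l" "l \<le> k" "l \<le> j" "k + j - N \<le> l" and m: "0 \<le> m"
    and W: "\<And>i. N - k - j \<le> i \<Longrightarrow> i < 0 \<Longrightarrow> s (W + of_int (m + k) + of_int i) \<noteq> 0"
    and gen: "\<And>i::int. s (lam + of_int i) \<noteq> 0" "\<And>i::int. s (lam - \<omega> + of_int i) \<noteq> 0"
      "\<And>i::int. s (W + lam + of_int i) \<noteq> 0" "\<And>i::int. s (W + \<omega> - lam + of_int i) \<noteq> 0"
  shows "tau_prefactor s N k j m \<omega> W lam * tau_summand s N k j l m \<omega> W lam = word_coef s N k j l m \<omega> W lam"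
proof -
  define Z where "Z = W + \<omega>"
  have Xc: "P (W + lam + of_int (N - 2*j + m + 1)) j / P (W + lam + of_int (N - 2*j + m + 1)) l
      = P (W + lam + of_int (N + m - 2*j + l + 1)) (j - l)"
    using ratio_at_generic_base[of l j "W + lam" "N - 2*j + m + 1"] l gen by (simp add: algebra_simps)
  have Yc: "P (Z - lam + of_int (2*j - m - k - 1)) k / P (- (Z - lam + of_int (2*j - m - 2))) l
      = alt l * P (Z - lam + of_int (2*j - m - k - 1)) (k - l)"
    using reflected_ratio_at_generic_base[of l k "Z - lam" "2*j - m - 2"] l gen by (simp add: Z_def algebra_simps)
  have Vc: "P (- (lam - \<omega> + of_int (N - 2*j + m))) (N - k - j) * P (lam - \<omega> + of_int (N - 2*j + m + 1)) l
      = alt (N - k - j) * P (lam - \<omega> + of_int (m + k - j + 1)) (N - k - j + l)"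
    using reflected_join_at_generic_base[of "lam - \<omega>" "N - 2*j + m" "N - k - j" l] gen by (simp add: algebra_simps)
  have Wc: "P (W + of_int (m + k)) (N - k - j) * P (- (W + of_int (m + k - 1))) l
      = alt l * P (W + of_int (m + k - l)) (N - k - j + l)"
    by (rule W_factors) (use l W in auto)
  note Zc = Z_factors[where Z = Z, OF l(1,4,3,2)]
  have Ic: "P (of_int (m + k - j + 1)) j / P 1 j * (P (- of_int k) l * P (- of_int j) l)
      / (P 1 l * P (- of_int (m + k)) l) * P (of_int (N - k - j + 1 + l)) (j - l)
      = alt l * (P (of_int (k - l + 1)) l / P 1 l) * (P (of_int (N - k - j + l + 1)) (j - l) / P 1 (j - l))
      * P (of_int (m + k - j + 1)) (j - l)"
    by (rule integer_factors) (use s_int l m in auto)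
  note Lc = lam_factors[where lam = lam and N = N and k = k and j = j and l = l and m = m, OF gen(1)]
  have s1: "s 1 \<noteq> 0" using s_int[of 1] by simp
  have s1c: "s 1 powi (k - j) = s 1 powi (k - l) / s 1 powi (j - l)"
    using s1 by (simp flip: power_int_diff)
  have m1: "(- s 1) powi (k - l) = alt (k - l) * s 1 powi (k - l)"
    by (simp flip: power_int_mult_distrib)
  have signs: "alt (N - k) * (alt l * alt l * alt l * alt (N - k - j) * (alt j * alt k)) = alt (k - l)"
    by (cases "even N"; cases "even k"; cases "even j"; cases "even l") simp_all
  have "tau_prefactor s N k j m \<omega> W lam * tau_summand s N k j l m \<omega> W lam =
      alt (N - k) * (s 1 powi (k - j))
      * (P (of_int (m + k - j + 1)) j / P 1 j * (P (- of_int k) l * P (- of_int j) l)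
          / (P 1 l * P (- of_int (m + k)) l) * P (of_int (N - k - j + 1 + l)) (j - l))
      * P (\<omega> + of_int (l - m - k + 1)) (j - l)
      * (P (Z + of_int (N - m - k)) l / P Z N)
      * (P (W + of_int (m + k)) (N - k - j) * P (- (W + of_int (m + k - 1))) l)
      * (P (W + lam + of_int (N - 2*j + m + 1)) j / P (W + lam + of_int (N - 2*j + m + 1)) l)
      * (P (Z - lam + of_int (2*j - m - k - 1)) k / P (- (Z - lam + of_int (2*j - m - 2))) l)
      * (P (- (lam - \<omega> + of_int (N - 2*j + m))) (N - k - j) * P (lam - \<omega> + of_int (N - 2*j + m + 1)) l)
      * (P (- (lam + of_int 1)) j / (P (lam + of_int (N - k - 2*j + 2)) j * P (lam + of_int (2 - j)) j)
      / P (- (lam + of_int (N - 2*j))) k / P (lam + of_int (1 - j)) (N - k - j)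
      * (s (lam + of_int (N - 2*j - k + 1 + 2*l)) / s (lam + of_int (N - 2*j - k + 1)))
      * (P (lam + of_int (N - 2*j - k + 1)) l * P (lam + of_int (N + 2 + m - 2*j)) l * P (lam + of_int (1 - j)) l)
      / (P (lam + of_int (N - 2*j + 2)) l * P (lam + of_int (N - j - k + 2)) l))"
    unfolding tau_prefactor_def tau_summand_def Let_def Z_def[symmetric]
    by (simp only: divide_inverse inverse_mult_distrib mult_1_left mult_ac)
  also have "\<dots> = word_coef s N k j l m \<omega> W lam"
    unfolding Ic Wc Xc Yc Vc Lc s1c Zc[symmetric]
    unfolding word_coef_def Let_def Z_def[symmetric] m1 signs[symmetric]
    by (simp only: divide_inverse inverse_mult_distrib mult_1_left mult_ac)
  finally show ?thesis .
qed

text \<open>The factorial \<open>(q\<^bsup>2(N-k-j+l+1)\<^esup>)\<^bsub>j-l\<^esub>\<close> passes through \<open>\<theta>(1) = 0\<close>.\<close>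

lemma tau_summand_eq_0:
  assumes "l \<le> j" "l < k + j - N" "k \<le> N"
  shows "tau_summand s N k j l m \<omega> W lam = 0"
proof -
  have "s 0 = 0" using odd[of 0] by simp
  then have "P (of_int (N - k - j + 1 + l)) (j - l) = 0"
    using assms by (auto simp: shifted_prod_def intro!: bexI[of _ "k + j - N - l - 1"])
  then show ?thesis by (simp add: tau_summand_def Let_def)
qed

end

section \<open>Cancellation of the powers of q\<close>

lemma qpow_combine:
  "qpow q a * qpow q b = qpow q (a + b)" "qpow q a / qpow q b = qpow q (a - b)"
  "inverse (qpow q a) = qpow q (- a)"
  by (simp_all add: qpow_add qpow_minus diff_conv_add_uminus divide_inverse del: add_uminus_conv_diff)

text \<open>If every factor of an expression has the form \<open>q\<^sup>a x\<close>, these rules move all powers of \<open>q\<close> to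
  the front, where they become a single exponent.\<close>

lemma qpow_collect:
  "(qpow q a * x) * (qpow q b * y) = qpow q (a + b) * (x * y)"
  "(qpow q a * x) / (qpow q b * y) = qpow q (a - b) * (x / y)"
  "qpow q a * (qpow q b * y) = qpow q (a + b) * y"
  "(qpow q a * x) * qpow q b = qpow q (a + b) * x"
  by (simp_all flip: qpow_combine(1,2))

lemma qpow_cong: "a = b \<Longrightarrow> qpow q a = qpow q b"
  by simp

lemma qpow_drop: "a = 0 \<Longrightarrow> qpow q a * x = x"
  by simp

lemma theta_qpow: "a = 2 * x \<Longrightarrow> theta p (qpow q a) = qpow q x * odd_theta p q x"
  using theta_eq_odd_theta by simp

lemma tfact_qpow: "a = 2 * x \<Longrightarrow> tfact p q (qpow q a) n =
     qpow q (of_int n * x + of_int (n * (n - 1)) / 2) * shifted_prod (odd_theta p q) x n"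
  using tfact_eq_shifted_prod by simp

lemma ell_binomial_odd_theta:
  assumes "0 \<le> l"
  shows "ell_binomial p q k l = qpow q (of_int (l * (k - l))) *
    (shifted_prod (odd_theta p q) (of_int (k - l + 1)) l / shifted_prod (odd_theta p q) 1 l)"
proof -
  have *: "(\<Prod>i\<in>{1..l}. theta p (qpow q (2 * of_int (a + i)))) = tfact p q (qpow q (2 * of_int (a + 1))) l" for a
    unfolding tfact_def if_P[OF assms] qpow_combine
    by (rule prod.reindex_bij_witness[of _ "\<lambda>i. i + 1" "\<lambda>i. i - 1"])
       (auto intro!: arg_cong[where f = "theta p"] qpow_cong simp: algebra_simps)
  have "ell_binomial p q k l = tfact p q (qpow q (2 * of_int (k - l + 1))) l / tfact p q (qpow q (2 * of_int (0 + 1))) l"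
    unfolding *[symmetric] by (simp add: ell_binomial_def prod_dividef)
  also have "\<dots> = qpow q (of_int (l * (k - l))) *
    (shifted_prod (odd_theta p q) (of_int (k - l + 1)) l / shifted_prod (odd_theta p q) 1 l)"
    unfolding tfact_eq_shifted_prod qpow_collect
    by (intro arg_cong2[where f = "(*)"] qpow_cong) (simp_all add: field_simps)
  finally show ?thesis .
qed

lemma t_coef_odd_theta:
  "t_coef p q N k j l lam = qpow q (of_int (- l * (k - l) - (j - l) * (N - k - (j - l)))) *
     (let P = shifted_prod (odd_theta p q) in
       P (lam + of_int (N - k - 2*j + l + 2)) l / P (lam + of_int (N - 2*j + 2)) l
         * (P (lam + of_int (l - j + 2)) (j - l) / P (lam + of_int (N - 2*j - k + 2*l + 2)) (j - l)))"
  unfolding t_coef_def tfact_eq_shifted_prod qpow_collect Let_def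
  by (intro arg_cong2[where f = "(*)"] qpow_cong refl) (simp add: field_simps)

context
  fixes p q :: real
  assumes p: "0 < p" "p < 1" and q: "0 < q" "q < 1"
begin

lemma theta_qpow_minus: "a = - 2 * x \<Longrightarrow> theta p (qpow q a) = qpow q (- x) * - odd_theta p q x"
  using theta_qpow[of a "- x" p q] by (simp add: odd_theta_minus[OF p q])

text \<open>With \<open>z = q\<^bsup>2W+\<omega>-1\<^esup>\<close> the powers of \<open>q\<close> in the four coefficients cancel completely. Only \<open>\<beta>\<close>
  retains a sign.\<close>

lemma coefA_odd_theta:
  "coefA p q \<omega> k lam (qpow q (2 * W + \<omega> - 1)) =
     odd_theta p q (lam + 1 + of_int k) * odd_theta p q (W + \<omega> - of_int k) / (odd_theta p q (lam + 1) * odd_theta p q (W + \<omega>))"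
proof -
  have *: "theta p (qpow q (- 2 * (lam + 1) - 2 * of_int k)) = qpow q (- (lam + 1 + of_int k)) * - odd_theta p q (lam + 1 + of_int k)"
    "theta p (qpow q (2 * W + \<omega> - 1) * qpow q (\<omega> - 2 * of_int k + 1)) = qpow q (W + \<omega> - of_int k) * odd_theta p q (W + \<omega> - of_int k)"
    "theta p (qpow q (- 2 * (lam + 1))) = qpow q (- (lam + 1)) * - odd_theta p q (lam + 1)"
    "theta p (qpow q (2 * W + \<omega> - 1) * qpow q (\<omega> + 1)) = qpow q (W + \<omega>) * odd_theta p q (W + \<omega>)"
    unfolding qpow_combine
    by (rule theta_qpow_minus theta_qpow, simp add: algebra_simps)+
  show ?thesis
    unfolding coefA_def * qpow_collect times_divide_eq_right
    by (subst qpow_drop) (simp_all add: algebra_simps)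
qed

lemma coefB_odd_theta:
  "coefB p q \<omega> k lam (qpow q (2 * W + \<omega> - 1)) =
     - odd_theta p q 1 * odd_theta p q (W + \<omega> - lam - 2 - of_int k) / (odd_theta p q (lam + 1) * odd_theta p q (W + \<omega>))"
proof -
  have *: "theta p (qpow q 2) = qpow q 1 * odd_theta p q 1"
    "theta p (qpow q (2 * W + \<omega> - 1) * qpow q (- 2 * (lam + 1) + \<omega> - 2 * of_int k - 1)) =
      qpow q (W + \<omega> - lam - 2 - of_int k) * odd_theta p q (W + \<omega> - lam - 2 - of_int k)"
    "theta p (qpow q (- 2 * (lam + 1))) = qpow q (- (lam + 1)) * - odd_theta p q (lam + 1)"
    "theta p (qpow q (2 * W + \<omega> - 1) * qpow q (\<omega> + 1)) = qpow q (W + \<omega>) * odd_theta p q (W + \<omega>)"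
    unfolding qpow_combine
    by (rule theta_qpow_minus theta_qpow, simp add: algebra_simps)+
  show ?thesis
    unfolding coefB_def * qpow_collect times_divide_eq_right
    by (subst qpow_drop) (simp_all add: algebra_simps)
qed

lemma coefC_odd_theta:
  "coefC p q \<omega> k lam (qpow q (2 * W + \<omega> - 1)) =
     odd_theta p q (of_int k) * odd_theta p q (\<omega> - of_int k + 1) * odd_theta p q (W + lam + of_int k)
       / (odd_theta p q 1 * odd_theta p q (lam + 1) * odd_theta p q (W + \<omega>))"
proof (cases "k = 0")
  case True
  then show ?thesis by (simp add: coefC_def odd_theta_0[OF p q])
next
  case False
  have *: "theta p (qpow q 2) = qpow q 1 * odd_theta p q 1"
    "theta p (qpow q (2 * of_int k)) = qpow q (of_int k) * odd_theta p q (of_int k)"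
    "theta p (qpow q (2 * (\<omega> - of_int k + 1))) = qpow q (\<omega> - of_int k + 1) * odd_theta p q (\<omega> - of_int k + 1)"
    "theta p (qpow q (2 * W + \<omega> - 1) * qpow q (2 * (lam + 1) - \<omega> + 2 * of_int k - 1)) =
      qpow q (W + lam + of_int k) * odd_theta p q (W + lam + of_int k)"
    "theta p (qpow q (2 * (lam + 1))) = qpow q (lam + 1) * odd_theta p q (lam + 1)"
    "theta p (qpow q (2 * W + \<omega> - 1) * qpow q (\<omega> + 1)) = qpow q (W + \<omega>) * odd_theta p q (W + \<omega>)"
    unfolding qpow_combine
    by (rule theta_qpow, simp add: algebra_simps)+
  show ?thesis
    unfolding coefC_def if_not_P[OF False] * qpow_collect times_divide_eq_right
    by (subst qpow_drop) (simp_all add: algebra_simps)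
qed

lemma coefD_odd_theta:
  "coefD p q \<omega> k lam (qpow q (2 * W + \<omega> - 1)) =
     odd_theta p q (lam + 1 - \<omega> + of_int k) * odd_theta p q (W + of_int k) / (odd_theta p q (lam + 1) * odd_theta p q (W + \<omega>))"
proof -
  have *: "theta p (qpow q (- 2 * (lam + 1 - \<omega> + of_int k))) = qpow q (- (lam + 1 - \<omega> + of_int k)) * - odd_theta p q (lam + 1 - \<omega> + of_int k)"
    "theta p (qpow q (2 * W + \<omega> - 1) * qpow q (- \<omega> + 2 * of_int k + 1)) = qpow q (W + of_int k) * odd_theta p q (W + of_int k)"
    "theta p (qpow q (- 2 * (lam + 1))) = qpow q (- (lam + 1)) * - odd_theta p q (lam + 1)"
    "theta p (qpow q (2 * W + \<omega> - 1) * qpow q (\<omega> + 1)) = qpow q (W + \<omega>) * odd_theta p q (W + \<omega>)"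
    unfolding qpow_combine
    by (rule theta_qpow_minus theta_qpow, simp add: algebra_simps)+
  show ?thesis
    unfolding coefD_def * qpow_collect times_divide_eq_right
    by (subst qpow_drop) (simp_all add: algebra_simps)
qed

end

lemma powi_qpow: "qpow q a powi n = qpow q (of_int n * a)"
  by (simp add: qpow_def exp_power_int algebra_simps)

text \<open>The exponent of \<open>q\<close> vanishes in each term separately, so the explicit power of \<open>q\<close> in \<open>\<tau>\<close>
  together with \<open>q\<^bsup>2s\<^esup>\<close> is exactly the correction needed to pass from \<open>\<theta>\<close> to the odd function.\<close>

lemma tau_odd_theta:
  "tau p q N \<omega> k j m lam (qpow q (2 * W + \<omega> - 1)) =
     (\<Sum>l\<in>{0..min k j}. tau_prefactor (odd_theta p q) N k j m \<omega> W lam * tau_summand (odd_theta p q) N k j l m \<omega> W lam)"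
proof -
  let ?z = "qpow q (2 * W + \<omega> - 1)"
  let ?S = "shifted_prod (odd_theta p q)"
  let ?e = "\<lambda>(n::int) x. of_int n * x + of_int (n * (n - 1)) / 2 :: complex"
  \<comment> \<open>The sign and the power of \<open>\<theta>(q\<^sup>2)\<close> are brought into the form \<open>q\<^sup>a x\<close> as well.\<close>
  define sg :: complex where "sg = (- 1) powi (N - k)"
  have sg: "(- 1) powi (N - k) = qpow q 0 * sg" by (simp add: sg_def)
  have th1: "theta p (qpow q 2) powi (k - j) = qpow q (of_int (k - j)) * odd_theta p q 1 powi (k - j)"
    by (subst theta_qpow[of 2 1]) (simp_all add: power_int_mult_distrib powi_qpow)
  define Q where "Q = 3/2 * of_int (k * (k - 1)) + of_int (N * (N + 1)) + 5/2 * of_int (j * (j + 1))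
               + 2 * of_int N * (lam - of_int k - 2 * of_int j)
               + of_int (m * (k - j)) + of_int (3 * j * k) - 2 * of_int k * lam"
  have pre:
    "tfact p q (qpow q (- 2 * (lam + 1))) j = qpow q (?e j (- (lam + of_int 1))) * ?S (- (lam + of_int 1)) j"
    "tfact p q (qpow q (2 * of_int (m + k - j + 1))) j = qpow q (?e j (of_int (m + k - j + 1))) * ?S (of_int (m + k - j + 1)) j"
    "tfact p q (?z * qpow q (2 * (lam + of_int (N - 2*j + m + 2)) - \<omega> - 1)) j =
      qpow q (?e j (W + lam + of_int (N - 2*j + m + 1))) * ?S (W + lam + of_int (N - 2*j + m + 1)) j"
    "tfact p q (qpow q 2) j = qpow q (?e j 1) * ?S 1 j"
    "tfact p q (qpow q (2 * (lam + of_int (N - k - 2*j + 2)))) j = qpow q (?e j (lam + of_int (N - k - 2*j + 2))) * ?S (lam + of_int (N - k - 2*j + 2)) j"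
    "tfact p q (qpow q (2 * (lam + of_int (2 - j)))) j = qpow q (?e j (lam + of_int (2 - j))) * ?S (lam + of_int (2 - j)) j"
    "tfact p q (?z * qpow q (- 2 * (lam + of_int (m + k - 2*j)) + \<omega> - 1)) k =
      qpow q (?e k (W + \<omega> - lam + of_int (2*j - m - k - 1))) * ?S (W + \<omega> - lam + of_int (2*j - m - k - 1)) k"
    "tfact p q (qpow q (- 2 * (lam + of_int (N - 2*j)))) k = qpow q (?e k (- (lam + of_int (N - 2*j)))) * ?S (- (lam + of_int (N - 2*j))) k"
    "tfact p q (qpow q (- 2 * (lam + of_int (N - 2*j + m) - \<omega>))) (N - k - j) =
      qpow q (?e (N - k - j) (- (lam - \<omega> + of_int (N - 2*j + m)))) * ?S (- (lam - \<omega> + of_int (N - 2*j + m))) (N - k - j)"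
    "tfact p q (?z * qpow q (2 * of_int (m + k) - \<omega> + 1)) (N - k - j) =
      qpow q (?e (N - k - j) (W + of_int (m + k))) * ?S (W + of_int (m + k)) (N - k - j)"
    "tfact p q (qpow q (2 * (lam + of_int (1 - j)))) (N - k - j) =
      qpow q (?e (N - k - j) (lam + of_int (1 - j))) * ?S (lam + of_int (1 - j)) (N - k - j)"
    unfolding qpow_combine
    by (rule tfact_qpow, simp add: algebra_simps)+
  have "tfact p q (?z * qpow q (\<omega> + 1)) N = qpow q (?e N (W + \<omega>)) * ?S (W + \<omega>) N"
    unfolding qpow_combine by (rule tfact_qpow) (simp add: algebra_simps)
  then have pre_N: "1 / tfact p q (?z * qpow q (\<omega> + 1)) N = qpow q (- ?e N (W + \<omega>)) * (1 / ?S (W + \<omega>) N)"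
    unfolding qpow_minus by simp
  have summand:
    "theta p (qpow q (2 * (lam + of_int (N - 2*j - k + 1))) * qpow q (4 * of_int l)) =
      qpow q (lam + of_int (N - 2*j - k + 1 + 2*l)) * odd_theta p q (lam + of_int (N - 2*j - k + 1 + 2*l))"
    "theta p (qpow q (2 * (lam + of_int (N - 2*j - k + 1)))) =
      qpow q (lam + of_int (N - 2*j - k + 1)) * odd_theta p q (lam + of_int (N - 2*j - k + 1))"
    "tfact p q (qpow q (2 * (lam + of_int (N - 2*j - k + 1)))) l = qpow q (?e l (lam + of_int (N - 2*j - k + 1))) * ?S (lam + of_int (N - 2*j - k + 1)) l"
    "tfact p q (qpow q (- 2 * of_int k)) l = qpow q (?e l (- of_int k)) * ?S (- of_int k) l"
    "tfact p q (qpow q (- 2 * of_int j)) l = qpow q (?e l (- of_int j)) * ?S (- of_int j) l"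
    "tfact p q (qpow q (2 * (lam + of_int (N + 2 + m - 2*j)))) l = qpow q (?e l (lam + of_int (N + 2 + m - 2*j))) * ?S (lam + of_int (N + 2 + m - 2*j)) l"
    "tfact p q (?z * qpow q (2 * of_int (N - m - k) + \<omega> + 1)) l = qpow q (?e l (W + \<omega> + of_int (N - m - k))) * ?S (W + \<omega> + of_int (N - m - k)) l"
    "tfact p q (inverse ?z * qpow q (- 2 * of_int (m + k - 1) + \<omega> - 1)) l = qpow q (?e l (- (W + of_int (m + k - 1)))) * ?S (- (W + of_int (m + k - 1))) l"
    "tfact p q (qpow q (2 * (lam + of_int (1 - j)))) l = qpow q (?e l (lam + of_int (1 - j))) * ?S (lam + of_int (1 - j)) l"
    "tfact p q (qpow q (2 * (lam + of_int (N - 2*j + m + 1) - \<omega>))) l = qpow q (?e l (lam - \<omega> + of_int (N - 2*j + m + 1))) * ?S (lam - \<omega> + of_int (N - 2*j + m + 1)) l"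
    "tfact p q (qpow q 2) l = qpow q (?e l 1) * ?S 1 l"
    "tfact p q (qpow q (2 * (lam + of_int (N - 2*j - k + 1))) * qpow q 2 / qpow q (- 2 * of_int k)) l =
      qpow q (?e l (lam + of_int (N - 2*j + 2))) * ?S (lam + of_int (N - 2*j + 2)) l"
    "tfact p q (qpow q (2 * (lam + of_int (N - 2*j - k + 1))) * qpow q 2 / qpow q (- 2 * of_int j)) l =
      qpow q (?e l (lam + of_int (N - j - k + 2))) * ?S (lam + of_int (N - j - k + 2)) l"
    "tfact p q (qpow q (2 * (lam + of_int (N - 2*j - k + 1))) * qpow q 2 / qpow q (2 * (lam + of_int (N + 2 + m - 2*j)))) l =
      qpow q (?e l (- of_int (m + k))) * ?S (- of_int (m + k)) l"
    "tfact p q (qpow q (2 * (lam + of_int (N - 2*j - k + 1))) * qpow q 2 / (?z * qpow q (2 * of_int (N - m - k) + \<omega> + 1))) l =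
      qpow q (?e l (- (W + \<omega> - lam + of_int (2*j - m - 2)))) * ?S (- (W + \<omega> - lam + of_int (2*j - m - 2))) l"
    "tfact p q (qpow q (2 * (lam + of_int (N - 2*j - k + 1))) * qpow q 2 / (inverse ?z * qpow q (- 2 * of_int (m + k - 1) + \<omega> - 1))) l =
      qpow q (?e l (W + lam + of_int (N - 2*j + m + 1))) * ?S (W + lam + of_int (N - 2*j + m + 1)) l"
    "tfact p q (qpow q (2 * (lam + of_int (N - 2*j - k + 1))) * qpow q 2 / qpow q (2 * (lam + of_int (1 - j))) * qpow q (2 * of_int l)) (j - l) =
      qpow q (?e (j - l) (of_int (N - k - j + 1 + l))) * ?S (of_int (N - k - j + 1 + l)) (j - l)"
    "tfact p q (qpow q (2 * (lam + of_int (N - 2*j - k + 1))) * qpow q 2 / qpow q (2 * (lam + of_int (N - 2*j + m + 1) - \<omega>)) * qpow q (2 * of_int l)) (j - l) =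
      qpow q (?e (j - l) (\<omega> + of_int (l - m - k + 1))) * ?S (\<omega> + of_int (l - m - k + 1)) (j - l)" for l
    unfolding qpow_combine
    by (rule tfact_qpow theta_qpow, simp add: algebra_simps)+
  show ?thesis
    unfolding tau_def ehs_compensated_def sum_distrib_left Q_def[symmetric] sg
      tfacts_def list.map prod_list.Cons prod_list.Nil append.simps mult_1_right
  proof (rule sum.cong[OF refl], goal_cases)
    case (1 l)
    show ?case
      unfolding pre pre_N summand th1
      unfolding qpow_collect
      apply (subst qpow_drop)
      subgoal unfolding Q_def by (simp add: field_simps)
      subgoal unfolding tau_prefactor_def tau_summand_def Let_def sg_def
        by (simp only: divide_inverse inverse_mult_distrib mult_1_left mult_ac)
      done
  qed
qed

section \<open>Meromorphic functions as field elements\<close>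

lemma mero_of_mult:
  assumes "f meromorphic_on UNIV" "h meromorphic_on UNIV"
  shows "mero_of (\<lambda>x. f x * h x) = mero_of f * mero_of h"
  using assms by transfer (auto simp: mero_eq_def intro!: meromorphic_intros)

lemma mero_of_add:
  assumes "f meromorphic_on UNIV" "h meromorphic_on UNIV"
  shows "mero_of (\<lambda>x. f x + h x) = mero_of f + mero_of h"
  using assms by transfer (auto simp: mero_eq_def intro!: meromorphic_intros)

lemma mero_of_zero: "mero_of (\<lambda>_. 0) = 0"
  by transfer (auto simp: mero_eq_def)

lemma mero_of_sum:
  assumes "\<And>i. i \<in> A \<Longrightarrow> f i meromorphic_on UNIV"
  shows "mero_of (\<lambda>x. \<Sum>i\<in>A. f i x) = (\<Sum>i\<in>A. mero_of (f i))"
  using assms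
proof (induction A rule: infinite_finite_induct)
  case (insert i A)
  then have "(\<lambda>x. \<Sum>i\<in>A. f i x) meromorphic_on UNIV"
    by (auto intro!: meromorphic_intros)
  with insert show ?case by (simp add: mero_of_add)
qed (simp_all add: mero_of_zero)

lemma shift_mero_of:
  assumes "f meromorphic_on UNIV"
  shows "shift a (mero_of f) = mero_of (\<lambda>x. f (x + a))"
  using assms meromorphic_shift[OF assms] by transfer (simp add: mero_eq_def)

lemma shift_shift: "shift a (shift b f) = shift (a + b) f"
proof (transfer fixing: a b)
  fix f assume "mero_eq f f"
  then show "mero_eq (\<lambda>z. f (z + a + b)) (\<lambda>z. f (z + (a + b)))"
    using meromorphic_shift[of f "a + b"] by (simp add: mero_eq_def add.assoc)
qed

lemma shift_0: "shift 0 f = f"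
  by transfer (auto simp: mero_eq_def)

lemma mero_of_compose:
  assumes "f meromorphic_on UNIV" "h meromorphic_on UNIV"
  shows "mero_of f * shift a (mero_of h * shift b g) = mero_of (\<lambda>x. f x * h (x + a)) * shift (a + b) g"
  using assms
  by (simp add: shift_mult shift_shift shift_mero_of mero_of_mult meromorphic_shift mult.assoc)

text \<open>If the difference of the two functions were not identically zero, its zeros would be discrete,
  hence countable, and the plane would be a union of two countable sets. A countable exceptional
  set is thus as good as a discrete one.\<close>

lemma mero_of_eqI:
  assumes f: "f meromorphic_on UNIV" and g: "g meromorphic_on UNIV"
    and count: "countable {x. f x \<noteq> g x}"
  shows "mero_of f = mero_of g"
proof -
  have "(\<lambda>x. f x - g x) meromorphic_on UNIV" using f g by (intro meromorphic_intros)
  from meromorphic_imp_constant_or_avoid[OF this, of 0]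
  consider "\<forall>\<^sub>F x in cosparse UNIV. f x - g x = 0" | "\<forall>\<^sub>F x in cosparse UNIV. f x - g x \<noteq> 0"
    by auto
  then show ?thesis
  proof cases
    case 1
    then have "mero_eq f g" using f g by (simp add: mero_eq_def)
    then show ?thesis using f g by transfer simp
  next
    case 2
    then have "countable {x. \<not> (f x - g x \<noteq> 0)}"
      using sparse_imp_countable[of UNIV "{x. \<not> (f x - g x \<noteq> 0)}"] by (simp add: eventually_cosparse)
    then have "countable ({x. f x \<noteq> g x} \<union> {x. \<not> (f x - g x \<noteq> 0)})" using count by simp
    moreover have "{x. f x \<noteq> g x} \<union> {x. \<not> (f x - g x \<noteq> 0)} = (UNIV :: complex set)" by auto
    ultimately have "countable (UNIV :: complex set)" by (simp only:)
    then show ?thesis using uncountable_UNIV_complex by simp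
  qed
qed

section \<open>Strings of generators\<close>

lemma bvec_sum: "bvec (sum f A) n = (\<Sum>i\<in>A. bvec (f i) n)"
  by (induction A rule: infinite_finite_induct) (simp_all add: bvec_zero bvec_add)

lemma prod_ascending:
  assumes "r \<ge> 0"
  shows "(\<Prod>i\<in>{1..r}. s (x + of_int i)) = shifted_prod s (x + 1) r"
proof -
  have "(\<Prod>i\<in>{1..r}. s (x + of_int i)) = (\<Prod>i\<in>{0..<r}. s (x + 1 + of_int i))"
    by (rule prod.reindex_bij_witness[of _ "\<lambda>i. i + 1" "\<lambda>i. i - 1"]) (auto simp: algebra_simps)
  then show ?thesis using assms by (simp add: shifted_prod_def)
qed

lemma prod_descending:
  assumes "r \<ge> 0"
  shows "(\<Prod>i\<in>{1..r}. s (x - of_int i)) = shifted_prod s (x - of_int r) r"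
proof -
  have "(\<Prod>i\<in>{1..r}. s (x - of_int i)) = (\<Prod>i\<in>{0..<r}. s (x - of_int r + of_int i))"
    by (rule prod.reindex_bij_witness[of _ "\<lambda>i. r - i" "\<lambda>i. r - i"]) (auto simp: algebra_simps)
  then show ?thesis using assms by (simp add: shifted_prod_def)
qed

lemma prod_const_int: "r \<ge> 0 \<Longrightarrow> (\<Prod>i\<in>{1..r::int}. c) = (c :: complex) powi r"
  by (simp add: power_int_def)

context dynamical_rep
begin

lemma op_zero: "\<pi> x 0 = 0"
  using op_add[of x 0 0] by (metis add_0 add_cancel_right_right)

lemma hom_zero: "\<pi> 0 v = 0"
  using hom_add[of 0 0 v] by (metis add_0 add_cancel_right_right)

lemma hom_sum: "\<pi> (sum f A) v = (\<Sum>i\<in>A. \<pi> (f i) v)"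
  by (induction A rule: infinite_finite_induct) (simp_all add: hom_zero hom_add)

text \<open>The rightmost generator acts first and sees the index \<open>n\<close> itself; every generator
  to its left translates its coefficient by \<open>e\<close>. The predicate \<open>ok\<close> describes the indices at which the
  generators are known to act as stated: it is trivial for \<open>\<gamma>\<close>, which lowers the index, since
  \<open>e\<^sub>n = 0\<close> for negative \<open>n\<close>, and it is \<open>n \<ge> 0\<close> for the others.\<close>

lemma word_action:
  assumes step: "\<And>i n g. 1 \<le> i \<Longrightarrow> i \<le> int r \<Longrightarrow> ok n \<Longrightarrow>
      \<pi> (X i) (bvec g n) = bvec (mero_of (F n i) * shift e g) (n + d)"
    and ok: "\<And>n. ok n \<Longrightarrow> ok (n + d)"
    and mero: "\<And>n i. F n i meromorphic_on UNIV"
    and "ok n"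
  shows "\<pi> (\<Prod>i\<leftarrow>[1..int r]. X i) (bvec g n) =
    bvec (mero_of (\<lambda>lam. \<Prod>i\<in>{1..int r}. F (n + d * (int r - i)) i (lam + e * of_int (i - 1)))
      * shift (e * of_nat r) g) (n + d * int r)"
  using step \<open>ok n\<close>
proof (induction r arbitrary: n g)
  case 0
  then show ?case by (simp add: hom_one shift_0 mero_of_const_1)
next
  case (Suc r)
  let ?G = "\<lambda>lam. \<Prod>i\<in>{1..int r}. F (n + d + d * (int r - i)) i (lam + e * of_int (i - 1))"
  have G: "?G meromorphic_on UNIV"
    by (intro meromorphic_intros meromorphic_shift mero)
  have "[1..int (Suc r)] = [1..int r] @ [int r + 1]"
    by (simp add: upto_rec2)
  then have "\<pi> (\<Prod>i\<leftarrow>[1..int (Suc r)]. X i) (bvec g n) = \<pi> (\<Prod>i\<leftarrow>[1..int r]. X i) (\<pi> (X (int r + 1)) (bvec g n))"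
    by (simp add: hom_mult)
  also have "\<dots> = \<pi> (\<Prod>i\<leftarrow>[1..int r]. X i) (bvec (mero_of (F n (int r + 1)) * shift e g) (n + d))"
    by (simp add: Suc.prems)
  also have "\<dots> = bvec (mero_of ?G * shift (e * of_nat r) (mero_of (F n (int r + 1)) * shift e g)) (n + d + d * int r)"
    by (rule Suc.IH) (use Suc.prems ok in auto)
  also have "mero_of ?G * shift (e * of_nat r) (mero_of (F n (int r + 1)) * shift e g) =
      mero_of (\<lambda>lam. ?G lam * F n (int r + 1) (lam + e * of_nat r)) * shift (e * of_nat r + e) g"
    by (rule mero_of_compose[OF G mero])
  also have "(\<lambda>lam. ?G lam * F n (int r + 1) (lam + e * of_nat r)) =
      (\<lambda>lam. \<Prod>i\<in>{1..int (Suc r)}. F (n + d * (int (Suc r) - i)) i (lam + e * of_int (i - 1)))"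
  proof
    fix lam
    have "{1..int (Suc r)} = insert (int r + 1) {1..int r}" by auto
    then show "?G lam * F n (int r + 1) (lam + e * of_nat r) =
      (\<Prod>i\<in>{1..int (Suc r)}. F (n + d * (int (Suc r) - i)) i (lam + e * of_int (i - 1)))"
      by (simp add: algebra_simps)
  qed
  finally show ?case by (simp add: algebra_simps)
qed

end

text \<open>A representation together with a spectral parameter \<open>z = q\<^bsup>2W+\<omega>-1\<^esup>\<close> at which all generators
  occurring in a matrix element of the corepresentation of size \<open>N\<close> act without poles.\<close>

locale dynamical_rep_at = dynamical_rep +
  fixes W :: complex and N :: int
  assumes p: "0 < p" "p < 1" and q: "0 < q" "q < 1"
    and regular: "\<And>i::int. 0 \<le> i \<Longrightarrow> i < N \<Longrightarrow> qpow q (2 * W + \<omega> - 1) * qpow q (\<omega> + 1 + 2 * of_int i) \<notin> powers_of p"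
begin

abbreviation "z \<equiv> qpow q (2 * W + \<omega> - 1)"
abbreviation "P \<equiv> shifted_prod (odd_theta p q)"

lemma spectral_shift: "qpow q (2 * of_int i) * z = qpow q (2 * (W + of_int i) + \<omega> - 1)"
  unfolding qpow_combine by (intro qpow_cong) (simp add: algebra_simps)

lemma regular_shift: "0 \<le> i \<Longrightarrow> i < N \<Longrightarrow> qpow q (2 * of_int i) * z * qpow q (\<omega> + 1) \<notin> powers_of p"
  using regular[of i] by (simp add: qpow_combine algebra_simps)

lemmas odd_theta_mero = analytic_on_imp_meromorphic_on[OF odd_theta_analytic[OF p q]]
lemmas P_mero = shifted_prod_odd_theta_meromorphic[OF p q]

lemmas word_products = prod_const_int prod_ascending[where s = "odd_theta p q"] prod_descending[where s = "odd_theta p q"]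

text \<open>In the next four lemmas \<open>c - 1, \<dots>, c - r\<close> are the exponents of \<open>q\<^sup>2\<close> in a string of \<open>r\<close> generators of
  one kind.\<close>

lemma gamma_word:
  assumes r: "0 \<le> r" "r \<le> c" "c \<le> N"
  shows "\<pi> (\<Prod>i\<leftarrow>[1..r]. \<gamma> (qpow q (2 * of_int (c - i)) * z)) (bvec g n) =
    bvec (mero_of (\<lambda>lam. P (of_int (n - r + 1)) r * P (\<omega> + of_int (1 - n)) r * P (W + lam + of_int (c + n + 1 - 2 * r)) r
       / (odd_theta p q 1 powi r * P (lam + of_int (2 - r)) r * P (W + \<omega> + of_int (c - r)) r)) * shift (of_int (- r)) g) (n - r)"
proof -
  let ?F = "\<lambda>n i lam. odd_theta p q (of_int n) * odd_theta p q (\<omega> - of_int n + 1) * odd_theta p q (W + of_int (c - i) + lam + of_int n)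
       / (odd_theta p q 1 * odd_theta p q (lam + 1) * odd_theta p q (W + of_int (c - i) + \<omega>))"
  have "\<pi> (\<Prod>i\<leftarrow>[1..int (nat r)]. \<gamma> (qpow q (2 * of_int (c - i)) * z)) (bvec g n) =
    bvec (mero_of (\<lambda>lam. \<Prod>i\<in>{1..int (nat r)}. ?F (n + (- 1) * (int (nat r) - i)) i (lam + (- 1) * of_int (i - 1)))
      * shift ((- 1) * of_nat (nat r)) g) (n + (- 1) * int (nat r))"
  proof (rule word_action[where ok = "\<lambda>_. True"])
    fix i n :: int and g assume i: "1 \<le> i" "i \<le> int (nat r)"
    show "\<pi> (\<gamma> (qpow q (2 * of_int (c - i)) * z)) (bvec g n) = bvec (mero_of (?F n i) * shift (- 1) g) (n + - 1)"
    proof (cases "n \<ge> 0")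
      case True
      have "\<pi> (\<gamma> (qpow q (2 * of_int (c - i)) * z)) (bvec g n) =
          bvec (mero_of (\<lambda>lam. coefC p q \<omega> n lam (qpow q (2 * of_int (c - i)) * z)) * shift (- 1) g) (n - 1)"
        by (rule rep_\<gamma>) (use i r True regular_shift[of "c - i"] in auto)
      then show ?thesis by (simp only: spectral_shift coefC_odd_theta[OF p q] add_uminus_conv_diff)
    next
      case False
      then show ?thesis by (simp add: bvec_def op_zero)
    qed
  next
    show "?F n i meromorphic_on UNIV" for n i
      by (intro meromorphic_intros odd_theta_mero analytic_intros)
  qed auto
  moreover have "(\<Prod>i\<in>{1..r}. ?F (n + (- 1) * (r - i)) i (lam + (- 1) * of_int (i - 1))) =
      P (of_int (n - r + 1)) r * P (\<omega> + of_int (1 - n)) r * P (W + lam + of_int (c + n + 1 - 2 * r)) r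
       / (odd_theta p q 1 powi r * P (lam + of_int (2 - r)) r * P (W + \<omega> + of_int (c - r)) r)" for lam
  proof -
    have "?F (n + (- 1) * (r - i)) i (lam + (- 1) * of_int (i - 1)) =
      odd_theta p q (of_int (n - r) + of_int i) * odd_theta p q (\<omega> + of_int (1 - n + r) - of_int i)
        * odd_theta p q (W + lam + of_int (c + n + 1 - r) - of_int i)
       / (odd_theta p q 1 * odd_theta p q (lam + 2 - of_int i) * odd_theta p q (W + \<omega> + of_int c - of_int i))" for i
      by (simp add: algebra_simps)
    then show ?thesis
      by (simp only: prod.distrib prod_dividef word_products[OF r(1)]) (simp add: algebra_simps)
  qed
  ultimately show ?thesis using r by simp
qed

lemma delta_word:
  assumes r: "0 \<le> r" "r \<le> c" "c \<le> N" and n: "0 \<le> n"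
  shows "\<pi> (\<Prod>i\<leftarrow>[1..r]. \<delta> (qpow q (2 * of_int (c - i)) * z)) (bvec g n) =
    bvec (mero_of (\<lambda>lam. P (lam - \<omega> + of_int (n + 1)) r * P (W + of_int (c - r + n)) r
       / (P (lam + 1) r * P (W + \<omega> + of_int (c - r)) r)) * shift (of_int r) g) n"
proof -
  let ?F = "\<lambda>n i lam. odd_theta p q (lam + 1 - \<omega> + of_int n) * odd_theta p q (W + of_int (c - i) + of_int n)
     / (odd_theta p q (lam + 1) * odd_theta p q (W + of_int (c - i) + \<omega>))"
  have "\<pi> (\<Prod>i\<leftarrow>[1..int (nat r)]. \<delta> (qpow q (2 * of_int (c - i)) * z)) (bvec g n) =
    bvec (mero_of (\<lambda>lam. \<Prod>i\<in>{1..int (nat r)}. ?F (n + 0 * (int (nat r) - i)) i (lam + 1 * of_int (i - 1)))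
      * shift (1 * of_nat (nat r)) g) (n + 0 * int (nat r))"
  proof (rule word_action[where ok = "\<lambda>n. 0 \<le> n"])
    fix i n :: int and g assume i: "1 \<le> i" "i \<le> int (nat r)" and n: "0 \<le> n"
    have "\<pi> (\<delta> (qpow q (2 * of_int (c - i)) * z)) (bvec g n) =
          bvec (mero_of (\<lambda>lam. coefD p q \<omega> n lam (qpow q (2 * of_int (c - i)) * z)) * shift 1 g) n"
      by (rule rep_\<delta>) (use i r n regular_shift[of "c - i"] in auto)
    then show "\<pi> (\<delta> (qpow q (2 * of_int (c - i)) * z)) (bvec g n) = bvec (mero_of (?F n i) * shift 1 g) (n + 0)"
      by (simp only: spectral_shift coefD_odd_theta[OF p q] add_0_right)
  next
    show "?F n i meromorphic_on UNIV" for n i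
      by (intro meromorphic_intros odd_theta_mero analytic_intros)
  qed (use n in auto)
  moreover have "(\<Prod>i\<in>{1..r}. ?F (n + 0 * (r - i)) i (lam + 1 * of_int (i - 1))) =
      P (lam - \<omega> + of_int (n + 1)) r * P (W + of_int (c - r + n)) r
       / (P (lam + 1) r * P (W + \<omega> + of_int (c - r)) r)" for lam
  proof -
    have "?F (n + 0 * (r - i)) i (lam + 1 * of_int (i - 1)) =
      odd_theta p q (lam - \<omega> + of_int n + of_int i) * odd_theta p q (W + of_int (c + n) - of_int i)
       / (odd_theta p q (lam + of_int i) * odd_theta p q (W + \<omega> + of_int c - of_int i))" for i
      by (simp add: algebra_simps)
    then show ?thesis
      by (simp only: prod.distrib prod_dividef word_products[OF r(1)]) (simp add: algebra_simps)
  qed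
  ultimately show ?thesis using r by simp
qed

lemma alpha_word:
  assumes r: "0 \<le> r" "r \<le> c" "c \<le> N" and n: "0 \<le> n"
  shows "\<pi> (\<Prod>i\<leftarrow>[1..r]. \<alpha> (qpow q (2 * of_int (c - i)) * z)) (bvec g n) =
    bvec (mero_of (\<lambda>lam. P (lam + of_int (n + 2 - r)) r * P (W + \<omega> + of_int (c - n - r)) r
       / (P (lam + of_int (2 - r)) r * P (W + \<omega> + of_int (c - r)) r)) * shift (of_int (- r)) g) n"
proof -
  let ?F = "\<lambda>n i lam. odd_theta p q (lam + 1 + of_int n) * odd_theta p q (W + of_int (c - i) + \<omega> - of_int n)
     / (odd_theta p q (lam + 1) * odd_theta p q (W + of_int (c - i) + \<omega>))"
  have "\<pi> (\<Prod>i\<leftarrow>[1..int (nat r)]. \<alpha> (qpow q (2 * of_int (c - i)) * z)) (bvec g n) =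
    bvec (mero_of (\<lambda>lam. \<Prod>i\<in>{1..int (nat r)}. ?F (n + 0 * (int (nat r) - i)) i (lam + (- 1) * of_int (i - 1)))
      * shift ((- 1) * of_nat (nat r)) g) (n + 0 * int (nat r))"
  proof (rule word_action[where ok = "\<lambda>n. 0 \<le> n"])
    fix i n :: int and g assume i: "1 \<le> i" "i \<le> int (nat r)" and n: "0 \<le> n"
    have "\<pi> (\<alpha> (qpow q (2 * of_int (c - i)) * z)) (bvec g n) =
          bvec (mero_of (\<lambda>lam. coefA p q \<omega> n lam (qpow q (2 * of_int (c - i)) * z)) * shift (- 1) g) n"
      by (rule rep_\<alpha>) (use i r n regular_shift[of "c - i"] in auto)
    then show "\<pi> (\<alpha> (qpow q (2 * of_int (c - i)) * z)) (bvec g n) = bvec (mero_of (?F n i) * shift (- 1) g) (n + 0)"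
      by (simp only: spectral_shift coefA_odd_theta[OF p q] add_0_right)
  next
    show "?F n i meromorphic_on UNIV" for n i
      by (intro meromorphic_intros odd_theta_mero analytic_intros)
  qed (use n in auto)
  moreover have "(\<Prod>i\<in>{1..r}. ?F (n + 0 * (r - i)) i (lam + (- 1) * of_int (i - 1))) =
      P (lam + of_int (n + 2 - r)) r * P (W + \<omega> + of_int (c - n - r)) r
       / (P (lam + of_int (2 - r)) r * P (W + \<omega> + of_int (c - r)) r)" for lam
  proof -
    have "?F (n + 0 * (r - i)) i (lam + (- 1) * of_int (i - 1)) =
      odd_theta p q (lam + of_int (n + 2) - of_int i) * odd_theta p q (W + \<omega> + of_int (c - n) - of_int i)
       / (odd_theta p q (lam + 2 - of_int i) * odd_theta p q (W + \<omega> + of_int c - of_int i))" for i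
      by (simp add: algebra_simps)
    then show ?thesis
      by (simp only: prod.distrib prod_dividef word_products[OF r(1)]) (simp add: algebra_simps)
  qed
  ultimately show ?thesis using r by simp
qed

lemma beta_word:
  assumes r: "0 \<le> r" "r \<le> c" "c \<le> N" and n: "0 \<le> n"
  shows "\<pi> (\<Prod>i\<leftarrow>[1..r]. \<beta> (qpow q (2 * of_int (c - i)) * z)) (bvec g n) =
    bvec (mero_of (\<lambda>lam. (- odd_theta p q 1) powi r * P (W + \<omega> - lam + of_int (c - n - 1 - 2 * r)) r
       / (P (lam + 1) r * P (W + \<omega> + of_int (c - r)) r)) * shift (of_int r) g) (n + r)"
proof -
  let ?F = "\<lambda>n i lam. - odd_theta p q 1 * odd_theta p q (W + of_int (c - i) + \<omega> - lam - 2 - of_int n)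
     / (odd_theta p q (lam + 1) * odd_theta p q (W + of_int (c - i) + \<omega>))"
  have "\<pi> (\<Prod>i\<leftarrow>[1..int (nat r)]. \<beta> (qpow q (2 * of_int (c - i)) * z)) (bvec g n) =
    bvec (mero_of (\<lambda>lam. \<Prod>i\<in>{1..int (nat r)}. ?F (n + 1 * (int (nat r) - i)) i (lam + 1 * of_int (i - 1)))
      * shift (1 * of_nat (nat r)) g) (n + 1 * int (nat r))"
  proof (rule word_action[where ok = "\<lambda>n. 0 \<le> n"])
    fix i n :: int and g assume i: "1 \<le> i" "i \<le> int (nat r)" and n: "0 \<le> n"
    have "\<pi> (\<beta> (qpow q (2 * of_int (c - i)) * z)) (bvec g n) =
          bvec (mero_of (\<lambda>lam. coefB p q \<omega> n lam (qpow q (2 * of_int (c - i)) * z)) * shift 1 g) (n + 1)"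
      by (rule rep_\<beta>) (use i r n regular_shift[of "c - i"] in auto)
    then show "\<pi> (\<beta> (qpow q (2 * of_int (c - i)) * z)) (bvec g n) = bvec (mero_of (?F n i) * shift 1 g) (n + 1)"
      by (simp only: spectral_shift coefB_odd_theta[OF p q])
  next
    show "?F n i meromorphic_on UNIV" for n i
      by (intro meromorphic_intros odd_theta_mero analytic_intros)
  qed (use n in auto)
  moreover have "(\<Prod>i\<in>{1..r}. ?F (n + 1 * (r - i)) i (lam + 1 * of_int (i - 1))) =
      (- odd_theta p q 1) powi r * P (W + \<omega> - lam + of_int (c - n - 1 - 2 * r)) r
       / (P (lam + 1) r * P (W + \<omega> + of_int (c - r)) r)" for lam
  proof -
    have "?F (n + 1 * (r - i)) i (lam + 1 * of_int (i - 1)) =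
      - odd_theta p q 1 * odd_theta p q (W + \<omega> - lam + of_int (c - n - 1 - r) - of_int i)
       / (odd_theta p q (lam + of_int i) * odd_theta p q (W + \<omega> + of_int c - of_int i))" for i
      by (simp add: algebra_simps)
    then have "(\<Prod>i\<in>{1..r}. ?F (n + 1 * (r - i)) i (lam + 1 * of_int (i - 1))) =
      (\<Prod>i\<in>{1..r}. - odd_theta p q 1) * (\<Prod>i\<in>{1..r}. odd_theta p q (W + \<omega> - lam + of_int (c - n - 1 - r) - of_int i))
       / ((\<Prod>i\<in>{1..r}. odd_theta p q (lam + of_int i)) * (\<Prod>i\<in>{1..r}. odd_theta p q (W + \<omega> + of_int c - of_int i)))"
      by (simp only: prod.distrib prod_dividef)
    also have "\<dots> = (- odd_theta p q 1) powi r * P (W + \<omega> - lam + of_int (c - n - 1 - 2 * r)) r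
       / (P (lam + 1) r * P (W + \<omega> + of_int (c - r)) r)"
      unfolding word_products[OF r(1)]
      by (simp add: algebra_simps)
    finally show ?thesis .
  qed
  ultimately show ?thesis using r by simp
qed

section \<open>The action of the matrix elements\<close>

lemma word_coef_mero: "word_coef (odd_theta p q) N k j l m \<omega> W meromorphic_on UNIV"
proof -
  have "(\<lambda>lam. word_coef (odd_theta p q) N k j l m \<omega> W lam) meromorphic_on UNIV"
    unfolding word_coef_def Let_def
    by (intro meromorphic_intros P_mero analytic_intros)
  then show ?thesis by simp
qed

lemma summand_action:
  assumes "0 \<le> l" "l \<le> k" "l \<le> j" "k + j - N \<le> l" "k \<le> N" "j \<le> N" "0 \<le> m"
  shows "\<pi> (sc (ell_binomial p q k l * ell_binomial p q (N - k) (j - l))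
          (\<mu>\<^sub>r (mero_of (t_coef p q N k j l))
           * (\<Prod>i\<leftarrow>[1..j - l]. \<gamma> (qpow q (2 * of_int (N - k - i)) * z))
           * (\<Prod>i\<leftarrow>[1..N - k - j + l]. \<delta> (qpow q (2 * of_int (N - j - k + l - i)) * z))
           * (\<Prod>i\<leftarrow>[1..l]. \<alpha> (qpow q (2 * of_int (N - i)) * z))
           * (\<Prod>i\<leftarrow>[1..k - l]. \<beta> (qpow q (2 * of_int (N - l - i)) * z)))) (bvec g m) =
     bvec (mero_of (word_coef (odd_theta p q) N k j l m \<omega> W) * shift (of_int (N - 2 * j)) g) (m + k - j)"
proof -
  define r where "r = N - k - j + l"
  have r: "0 \<le> r" using assms by (simp add: r_def)
  define T where "T lam = (let P = P in
       P (lam + of_int (N - k - 2*j + l + 2)) l / P (lam + of_int (N - 2*j + 2)) l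
         * (P (lam + of_int (l - j + 2)) (j - l) / P (lam + of_int (N - 2*j - k + 2*l + 2)) (j - l)))" for lam
  define b where "b = (P (of_int (k - l + 1)) l / P 1 l) * (P (of_int (N - k - j + l + 1)) (j - l) / P 1 (j - l))"
  let ?c = "ell_binomial p q k l * ell_binomial p q (N - k) (j - l)"
  have coef: "?c * t_coef p q N k j l lam = b * T lam" for lam
  proof -
    have "?c = qpow q (of_int (l * (k - l))  + of_int ((j - l) * (N - k - (j - l)))) * b"
    proof -
      have "N - k - (j - l) + 1 = N - k - j + l + 1" "0 \<le> j - l" using assms by simp_all
      then show ?thesis
        using assms by (simp only: ell_binomial_odd_theta qpow_collect b_def)
    qed
    then show ?thesis
      unfolding t_coef_odd_theta T_def[symmetric]
      by (simp only: qpow_collect) (simp add: algebra_simps)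
  qed
  have T_mero: "T meromorphic_on UNIV"
    unfolding T_def [abs_def] Let_def by (intro meromorphic_intros P_mero analytic_intros)
  have t_mero: "t_coef p q N k j l meromorphic_on UNIV"
  proof -
    have "t_coef p q N k j l = (\<lambda>lam. qpow q (of_int (- l * (k - l) - (j - l) * (N - k - (j - l)))) * T lam)"
      unfolding T_def t_coef_odd_theta[abs_def] ..
    then show ?thesis using T_mero by (auto intro!: meromorphic_intros)
  qed
  \<comment> \<open>The coefficients of the four strings, each at the argument \<open>\<lambda>\<close> and at the index that the
    strings to its right have produced. The strings to the left translate the argument.\<close>
  define G where "G lam = P (of_int (m + k - l - (j - l) + 1)) (j - l) * P (\<omega> + of_int (1 - (m + k - l))) (j - l)
       * P (W + lam + of_int (N - k + (m + k - l) + 1 - 2 * (j - l))) (j - l)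
       / (odd_theta p q 1 powi (j - l) * P (lam + of_int (2 - (j - l))) (j - l) * P (W + \<omega> + of_int (N - k - (j - l))) (j - l))" for lam
  define D where "D lam = P (lam - \<omega> + of_int (m + k - l + 1)) r * P (W + of_int (r - r + (m + k - l))) r
       / (P (lam + 1) r * P (W + \<omega> + of_int (r - r)) r)" for lam
  define A where "A lam = P (lam + of_int (m + k - l + 2 - l)) l * P (W + \<omega> + of_int (N - (m + k - l) - l)) l
       / (P (lam + of_int (2 - l)) l * P (W + \<omega> + of_int (N - l)) l)" for lam
  define B where "B lam = (- odd_theta p q 1) powi (k - l) * P (W + \<omega> - lam + of_int (N - l - m - 1 - 2 * (k - l))) (k - l)
       / (P (lam + 1) (k - l) * P (W + \<omega> + of_int (N - l - (k - l))) (k - l))" for lam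
  have mero: "G meromorphic_on UNIV" "D meromorphic_on UNIV" "A meromorphic_on UNIV" "B meromorphic_on UNIV"
    unfolding G_def [abs_def] D_def [abs_def] A_def [abs_def] B_def [abs_def]
    by (intro meromorphic_intros P_mero analytic_intros)+
  have beta: "\<pi> (\<Prod>i\<leftarrow>[1..k - l]. \<beta> (qpow q (2 * of_int (N - l - i)) * z)) (bvec g m) =
      bvec (mero_of B * shift (of_int (k - l)) g) (m + k - l)"
    using beta_word[of "k - l" "N - l" m g] assms by (simp add: B_def [abs_def] add_diff_eq)
  have alpha: "\<pi> (\<Prod>i\<leftarrow>[1..l]. \<alpha> (qpow q (2 * of_int (N - i)) * z)) (bvec g (m + k - l)) =
      bvec (mero_of A * shift (of_int (- l)) g) (m + k - l)" for g
    using alpha_word[of l N "m + k - l" g] assms by (simp add: A_def [abs_def])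
  have delta: "\<pi> (\<Prod>i\<leftarrow>[1..r]. \<delta> (qpow q (2 * of_int (r - i)) * z)) (bvec g (m + k - l)) =
      bvec (mero_of D * shift (of_int r) g) (m + k - l)" for g
    using delta_word[of r r "m + k - l" g] assms r unfolding D_def [abs_def] by (simp add: r_def)
  have gamma: "\<pi> (\<Prod>i\<leftarrow>[1..j - l]. \<gamma> (qpow q (2 * of_int (N - k - i)) * z)) (bvec g (m + k - l)) =
      bvec (mero_of G * shift (of_int (- (j - l))) g) (m + k - j)" for g
    using gamma_word[where r = "j - l" and c = "N - k" and n = "m + k - l" and g = g] assms unfolding G_def [abs_def]
    by (simp add: algebra_simps)
  \<comment> \<open>The index \<open>m + k - j\<close> may be negative here, and then both sides vanish.\<close>
  have mu: "\<pi> (\<mu>\<^sub>r f) (bvec g (m + k - j)) = bvec (f * g) (m + k - j)" for f g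
    using rep_\<mu>\<^sub>r[of "m + k - j" f g] by (cases "m + k - j \<ge> 0") (simp_all add: bvec_def op_zero)
  have "N - j - k + l = r" "N - k - j + l = r" by (simp_all add: r_def)
  then have "\<pi> (sc ?c (\<mu>\<^sub>r (mero_of (t_coef p q N k j l))
           * (\<Prod>i\<leftarrow>[1..j - l]. \<gamma> (qpow q (2 * of_int (N - k - i)) * z))
           * (\<Prod>i\<leftarrow>[1..N - k - j + l]. \<delta> (qpow q (2 * of_int (N - j - k + l - i)) * z))
           * (\<Prod>i\<leftarrow>[1..l]. \<alpha> (qpow q (2 * of_int (N - i)) * z))
           * (\<Prod>i\<leftarrow>[1..k - l]. \<beta> (qpow q (2 * of_int (N - l - i)) * z)))) (bvec g m) =
      scaleH ?c (bvec (mero_of (t_coef p q N k j l) * (mero_of G * shift (of_int (- (j - l)))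
        (mero_of D * shift (of_int r) (mero_of A * shift (of_int (- l)) (mero_of B * shift (of_int (k - l)) g))))) (m + k - j))"
    by (simp only: hom_scale hom_mult beta alpha delta gamma mu)
  also have "\<dots> = bvec (mero_of (\<lambda>_. ?c) * mero_of (t_coef p q N k j l) * (mero_of G * shift (of_int (- (j - l)))
        (mero_of D * shift (of_int r) (mero_of A * shift (of_int (- l)) (mero_of B * shift (of_int (k - l)) g))))) (m + k - j)"
    by (simp only: bvec_scale[symmetric] mult.assoc)
  also have "mero_of (\<lambda>_. ?c) * mero_of (t_coef p q N k j l) = mero_of (\<lambda>lam. b * T lam)"
    using t_mero by (simp add: coef[symmetric] mero_of_mult[symmetric] meromorphic_on_const)
  also have "mero_of A * shift (of_int (- l)) (mero_of B * shift (of_int (k - l)) g) =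
      mero_of (\<lambda>x. A x * B (x + of_int (- l))) * shift (of_int (- l) + of_int (k - l)) g"
    by (rule mero_of_compose) (rule mero)+
  also have "mero_of D * shift (of_int r) (mero_of (\<lambda>x. A x * B (x + of_int (- l))) * shift (of_int (- l) + of_int (k - l)) g) =
      mero_of (\<lambda>x. D x * (A (x + of_int r) * B (x + of_int r + of_int (- l)))) * shift (of_int r + (of_int (- l) + of_int (k - l))) g"
    by (rule mero_of_compose) (intro meromorphic_intros meromorphic_shift mero)+
  also have "mero_of G * shift (of_int (- (j - l))) \<dots> =
      mero_of (\<lambda>x. G x * (D (x + of_int (- (j - l))) * (A (x + of_int (- (j - l)) + of_int r) *
        B (x + of_int (- (j - l)) + of_int r + of_int (- l)))))
      * shift (of_int (- (j - l)) + (of_int r + (of_int (- l) + of_int (k - l)))) g"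
    by (rule mero_of_compose) (intro meromorphic_intros meromorphic_shift mero)+
  also have "mero_of (\<lambda>lam. b * T lam) * \<dots> = mero_of (\<lambda>x. (b * T x) * (G x * (D (x + of_int (- (j - l))) * (A (x + of_int (- (j - l)) + of_int r) *
        B (x + of_int (- (j - l)) + of_int r + of_int (- l))))))
      * shift (of_int (- (j - l)) + (of_int r + (of_int (- l) + of_int (k - l)))) g"
    unfolding mult.assoc[symmetric]
    by (subst mero_of_mult[symmetric]) (intro meromorphic_intros meromorphic_shift mero T_mero | simp add: mult_ac)+
  also have "of_int (- (j - l)) + (of_int r + (of_int (- l) + of_int (k - l))) = (of_int (N - 2 * j) :: complex)"
    by (simp add: r_def)
  also have "(\<lambda>x. (b * T x) * (G x * (D (x + of_int (- (j - l))) * (A (x + of_int (- (j - l)) + of_int r) *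
        B (x + of_int (- (j - l)) + of_int r + of_int (- l)))))) = word_coef (odd_theta p q) N k j l m \<omega> W"
  proof
    fix x :: complex
    have arg: "x + of_int (- (j - l)) + of_int r = x + of_int (N - k - 2*j + 2*l)"
      "x + of_int (N - k - 2*j + 2*l) + of_int (- l) = x + of_int (N - k - 2*j + l)"
      by (simp_all add: r_def)
    have G: "G x = P (of_int (m + k - j + 1)) (j - l) * P (\<omega> + of_int (l - m - k + 1)) (j - l)
           * P (W + x + of_int (N + m - 2*j + l + 1)) (j - l)
         / (odd_theta p q 1 powi (j - l) * P (x + of_int (l - j + 2)) (j - l) * P (W + \<omega> + of_int (N - k - j + l)) (j - l))"
      unfolding G_def by (simp add: algebra_simps)
    have D: "D (x + of_int (- (j - l))) = P (x - \<omega> + of_int (m + k - j + 1)) r * P (W + of_int (m + k - l)) r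
         / (P (x + of_int (l - j + 1)) r * P (W + \<omega>) r)"
      unfolding D_def by (simp add: algebra_simps)
    have A: "A (x + of_int (N - k - 2*j + 2*l)) = P (x + of_int (N - 2*j + m + 2)) l * P (W + \<omega> + of_int (N - m - k)) l
         / (P (x + of_int (N - k - 2*j + l + 2)) l * P (W + \<omega> + of_int (N - l)) l)"
      unfolding A_def by (simp add: algebra_simps)
    have B: "B (x + of_int (N - k - 2*j + l)) = (- odd_theta p q 1) powi (k - l) * P (W + \<omega> - x + of_int (2*j - m - k - 1)) (k - l)
         / (P (x + of_int (N - k - 2*j + l + 1)) (k - l) * P (W + \<omega> + of_int (N - k)) (k - l))"
      unfolding B_def by (simp add: algebra_simps)
    show "(b * T x) * (G x * (D (x + of_int (- (j - l))) * (A (x + of_int (- (j - l)) + of_int r) *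
        B (x + of_int (- (j - l)) + of_int r + of_int (- l))))) = word_coef (odd_theta p q) N k j l m \<omega> W x"
      unfolding arg G D A B word_coef_def Let_def b_def T_def r_def[symmetric]
      by (simp only: divide_inverse inverse_mult_distrib mult_ac)
  qed
  finally show ?thesis .
qed

lemma t_elem_action:
  assumes "0 \<le> k" "k \<le> N" "0 \<le> j" "j \<le> N" "0 \<le> m"
  shows "\<pi> (t_elem sc p q \<alpha> \<beta> \<gamma> \<delta> \<mu>\<^sub>r N k j z) (bvec g m) =
    bvec (mero_of (\<lambda>lam. \<Sum>l\<in>{max 0 (k + j - N)..min k j}. word_coef (odd_theta p q) N k j l m \<omega> W lam)
      * shift (of_int (N - 2 * j)) g) (m + k - j)"
proof -
  have "\<pi> (t_elem sc p q \<alpha> \<beta> \<gamma> \<delta> \<mu>\<^sub>r N k j z) (bvec g m) =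
    (\<Sum>l\<in>{max 0 (k + j - N)..min k j}.
       bvec (mero_of (word_coef (odd_theta p q) N k j l m \<omega> W) * shift (of_int (N - 2 * j)) g) (m + k - j))"
    unfolding t_elem_def hom_sum
    by (rule sum.cong[OF refl], rule summand_action) (use assms in auto)
  then show ?thesis
    by (simp add: bvec_sum[symmetric] sum_distrib_right[symmetric] mero_of_sum word_coef_mero)
qed

text \<open>The identity between single terms holds unless \<open>\<lambda>\<close> is one of countably many values: those for
  which \<open>\<sigma>\<close> has a zero in one of the four classes modulo \<open>\<int>\<close> that involve \<open>\<lambda>\<close>.\<close>

lemma mero_of_tau:
  assumes ai: "algebraically_independent2 p q" and "0 \<le> k" "k \<le> N" "0 \<le> j" "0 \<le> m"
    and Wreg: "\<And>i :: int. \<lbrakk>N - k - j \<le> i; i < 0\<rbrakk> \<Longrightarrow>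
           z * qpow q (2 * of_int (m + k) - \<omega> + 1 + 2 * of_int i) \<notin> powers_of p"
  shows "mero_of (\<lambda>lam. tau p q N \<omega> k j m lam z) =
    mero_of (\<lambda>lam. \<Sum>l\<in>{max 0 (k + j - N)..min k j}. word_coef (odd_theta p q) N k j l m \<omega> W lam)"
proof (rule mero_of_eqI)
  interpret odd_theta_fun: odd_function "odd_theta p q"
    by standard (rule odd_theta_minus[OF p q])
  show "(\<lambda>lam. tau p q N \<omega> k j m lam z) meromorphic_on UNIV"
    unfolding tau_odd_theta tau_prefactor_def tau_summand_def Let_def
    by (intro meromorphic_intros P_mero odd_theta_mero analytic_intros)
  show "(\<lambda>lam. \<Sum>l\<in>{max 0 (k + j - N)..min k j}. word_coef (odd_theta p q) N k j l m \<omega> W lam) meromorphic_on UNIV"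
    by (intro meromorphic_intros word_coef_mero)
  define E where "E a c = {x. \<exists>i::int. odd_theta p q (a * x + c + of_int i) = 0}" for a c
  have "countable (E a c)" if "a \<noteq> 0" for a c
    unfolding E_def by (rule countable_not_generic[OF p q that])
  then have E: "countable (E 1 0 \<union> E 1 (- \<omega>) \<union> E 1 W \<union> E (- 1) (W + \<omega>))"
    by simp
  show "countable {lam. tau p q N \<omega> k j m lam z \<noteq>
      (\<Sum>l\<in>{max 0 (k + j - N)..min k j}. word_coef (odd_theta p q) N k j l m \<omega> W lam)}"
  proof (rule countable_subset[OF _ E], rule subsetI, rule ccontr)
    fix lam
    assume neq: "lam \<in> {lam. tau p q N \<omega> k j m lam z \<noteq>
        (\<Sum>l\<in>{max 0 (k + j - N)..min k j}. word_coef (odd_theta p q) N k j l m \<omega> W lam)}"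
      and "lam \<notin> E 1 0 \<union> E 1 (- \<omega>) \<union> E 1 W \<union> E (- 1) (W + \<omega>)"
    then have gen: "odd_theta p q (lam + of_int i) \<noteq> 0" "odd_theta p q (lam - \<omega> + of_int i) \<noteq> 0"
      "odd_theta p q (W + lam + of_int i) \<noteq> 0" "odd_theta p q (W + \<omega> - lam + of_int i) \<noteq> 0" for i :: int
      by (auto simp: E_def algebra_simps)
    have Wnz: "odd_theta p q (W + of_int (m + k) + of_int i) \<noteq> 0" if "N - k - j \<le> i" "i < 0" for i
    proof
      assume "odd_theta p q (W + of_int (m + k) + of_int i) = 0"
      then have "qpow q (2 * (W + of_int (m + k) + of_int i)) \<in> powers_of p"
        by (rule odd_theta_eq_0_imp[OF p q])
      also have "qpow q (2 * (W + of_int (m + k) + of_int i)) = z * qpow q (2 * of_int (m + k) - \<omega> + 1 + 2 * of_int i)"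
        unfolding qpow_combine by (intro qpow_cong) (simp add: algebra_simps)
      finally show False using Wreg[OF that] by simp
    qed
    have "tau p q N \<omega> k j m lam z =
        (\<Sum>l\<in>{max 0 (k + j - N)..min k j}. tau_prefactor (odd_theta p q) N k j m \<omega> W lam * tau_summand (odd_theta p q) N k j l m \<omega> W lam)"
      unfolding tau_odd_theta
      by (rule sum.mono_neutral_right) (use assms odd_theta_fun.tau_summand_eq_0 in auto)
    also have "\<dots> = (\<Sum>l\<in>{max 0 (k + j - N)..min k j}. word_coef (odd_theta p q) N k j l m \<omega> W lam)"
      by (intro sum.cong refl odd_theta_fun.tau_summand_eq_word_coef odd_theta_of_int_nonzero[OF p q ai] gen Wnz)
         (use assms in auto)
    finally show False using neq by simp
  qed
qed

end

theorem lemma4p3: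
  fixes p q :: real and \<omega> z :: complex and N m k j :: int
    and sc :: "complex \<Rightarrow> 'a::ring_1 \<Rightarrow> 'a"
    and \<alpha> \<beta> \<gamma> \<delta> :: "complex \<Rightarrow> 'a" and \<mu>\<^sub>l \<mu>\<^sub>r :: "mero \<Rightarrow> 'a"
    and \<pi> :: "'a \<Rightarrow> (nat \<Rightarrow>\<^sub>0 mero) \<Rightarrow> (nat \<Rightarrow>\<^sub>0 mero)"
    and g :: mero
  assumes "0 < p" "p < 1" "0 < q" "q < 1" "algebraically_independent2 p q"
    and "dynamical_rep sc p q \<omega> \<alpha> \<beta> \<gamma> \<delta> \<mu>\<^sub>l \<mu>\<^sub>r \<pi>"
    and "0 \<le> N" "0 \<le> m" "0 \<le> k" "k \<le> N" "0 \<le> j" "j \<le> N"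
    and "z \<noteq> 0"
    and "\<And>i :: int. \<lbrakk>0 \<le> i; i < N\<rbrakk> \<Longrightarrow>
           z * qpow q (\<omega> + 1 + 2 * of_int i) \<notin> powers_of p"
    and "\<And>i :: int. \<lbrakk>N - k - j \<le> i; i < 0\<rbrakk> \<Longrightarrow>
           z * qpow q (2 * of_int (m + k) - \<omega> + 1 + 2 * of_int i) \<notin> powers_of p"
  shows "\<pi> (t_elem sc p q \<alpha> \<beta> \<gamma> \<delta> \<mu>\<^sub>r N k j z) (bvec g m) =
           bvec (mero_of (\<lambda>lam. tau p q N \<omega> k j m lam z) * shift (of_int (N - 2 * j)) g) (m + k - j)"
proof -
  \<comment> \<open>Any logarithm of \<open>z\<close> to the base \<open>q\<close> will do.\<close>
  define W where "W = (Ln z / of_real (ln q) - \<omega> + 1) / 2"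
  have "ln q \<noteq> 0" using assms by simp
  then have "2 * W + \<omega> - 1 = Ln z / of_real (ln q)"
    by (simp add: W_def field_simps)
  then have z: "z = qpow q (2 * W + \<omega> - 1)"
    using \<open>z \<noteq> 0\<close> \<open>ln q \<noteq> 0\<close> by (simp add: qpow_def)
  interpret dynamical_rep_at sc p q \<omega> \<alpha> \<beta> \<gamma> \<delta> \<mu>\<^sub>l \<mu>\<^sub>r \<pi> W N
    by (intro dynamical_rep_at.intro dynamical_rep_at_axioms.intro) (use assms z in auto)
  show ?thesis
    using t_elem_action[of k j m g] mero_of_tau[of k j m] assms z by auto
qed

end
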